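(* Let $K,L,A$ be as in the context and suppose there is an $A$-scaffold on $L$ of tolerance $\mathfrak{T}$ with shift parameters $b_1,\dots,b_n$. Let $h\in\mathbb{Z}$, and let $\mathfrak{A}$, $b$, $d$, $w$, $\mathcal{D}$, $\mathcal{E}$ be as in the context, and assume $\mathfrak{T}\ge p^n+b-h$. Then the minimal number of generators of the $\mathfrak{A}$-module $\mathfrak{P}_L^h$ is $|\mathcal{D}|$. Also, $\mathfrak{A}$ is a (not necessarily commutative) local ring with residue field $\kappa=\mathfrak{O}_K/\mathfrak{P}_K$, and, writing $\mathfrak{M}$ for its unique maximal ideal, the embedding dimension $\dim_\kappa(\mathfrak{M}/\mathfrak{M}^2)$ of $\mathfrak{A}$ is $|\mathcal{E}|$.
   Context: Let $K$ be a field complete with respect to a discrete valuation, with residue field $\kappa$ of characteristic $p>0$ ($\kappa$ need not be perfect; $K$ may have characteristic $0$ or $p$). Let $L/K$ be a totally ramified field extension of degree $p^n$; $v_K,v_L$ normalized valuations, $\mathfrak{O}_K,\mathfrak{O}_L$ valuation rings, $\mathfrak{P}_K,\mathfrak{P}_L$ maximal ideals. Let $A$ be a $K$-algebra with $\dim_K A=p^n$ acting $K$-linearly on $L$, written $\alpha\cdot x$. Let $\mathbb{S}_{p^n}=\{0,\dots,p^n-1\}$; write $s=\sum_{i=1}^n s_{(n-i)}p^{n-i}$ with digits in $\{0,\dots,p-1\}$; $s\preceq t$ means $s_{(n-i)}\le t_{(n-i)}$ for all $i$, and $s\prec t$ means $s\preceq t$ and $s\neq t$. Given integers $b_1,\dots,b_n$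 prime to $p$, put $\mathfrak{b}(s)=\sum_i s_{(n-i)}p^{n-i}b_i$; for $t\in\mathbb{Z}$ let $\mathfrak{a}(t)\in\mathbb{S}_{p^n}$ be the unique element with $\mathfrak{b}(\mathfrak{a}(t))\equiv-t\pmod{p^n}$ (digits $\mathfrak{a}(t)_{(n-i)}$). An $A$-scaffold on $L$ of tolerance $\mathfrak{T}\ge1$ (possibly $\infty$) with shift parameters $b_1,\dots,b_n$ consists of: (i) $\lambda_t\in L$ ($t\in\mathbb{Z}$) with $v_L(\lambda_t)=t$ and $\lambda_{t_1}\lambda_{t_2}^{-1}\in K$ whenever $t_1\equiv t_2\pmod{p^n}$; (ii) $\Psi_1,\dots,\Psi_n\in A$ with $\Psi_i\cdot1=0$ such that for each $i,t$ there is $u_{i,t}\in\mathfrak{O}_K^\times$ with $\Psi_i\cdot\lambda_t\equiv u_{i,t}\lambda_{t+p^{n-i}b_i}$ if $\mathfrak{a}(t)_{(n-i)}\ge1$ and $\equiv0$ if $\mathfrak{a}(t)_{(n-i)}=0$, modulo $\lambda_{t+p^{n-i}b_i}\mathfrak{P}_L^{\mathfrak{T}}$ (equalities if $\mathfrak{T}=\infty$). Fix $h\in\mathbb{Z}$; $\mathfrak{A}=\{\alpha\in A:\alpha\cdot\mathfrak{P}_L^h\subseteq\mathfrak{P}_L^h\}$. Let $b$ be the unique integer with $h\le b<h+p^n$ and $\mathfrak{a}(b)=p^n-1$. For $s\in\mathbb{S}_{p^n}$ let $d(s)=\lfloor(\mathfrak{b}(s)+b-h)/p^n\rfloor$ and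 $w(s)=\min\{d(u)-d(u-s):u\in\mathbb{S}_{p^n},\,u\succeq s\}$. Let $\mathcal{D}=\{u\in\mathbb{S}_{p^n}: d(u)>d(u-s)+w(s)\text{ for all }s\in\mathbb{S}_{p^n}\text{ with }0\prec s\preceq u\}$ and $\mathcal{E}=\{u\in\mathbb{S}_{p^n}: w(u)>w(u-s)+w(s)\text{ for all }s\in\mathbb{S}_{p^n}\text{ with }0\prec s\prec u\}$. *)

theory Defs
  imports Main "HOL-Library.Extended_Nat" "HOL-Computational_Algebra.Primes"
begin

definition digit :: "nat \<Rightarrow> nat \<Rightarrow> nat \<Rightarrow> nat" where
  "digit p j s = (s div p ^ j) mod p"

definition preceq :: "nat \<Rightarrow> nat \<Rightarrow> nat \<Rightarrow> nat \<Rightarrow> bool" where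
  "preceq p n s t = (\<forall>j<n. digit p j s \<le> digit p j t)"

definition prec :: "nat \<Rightarrow> nat \<Rightarrow> nat \<Rightarrow> nat \<Rightarrow> bool" where
  "prec p n s t = (preceq p n s t \<and> s \<noteq> t)"

definition bfrak :: "nat \<Rightarrow> nat \<Rightarrow> (nat \<Rightarrow> int) \<Rightarrow> nat \<Rightarrow> int" where
  "bfrak p n bs s = (\<Sum>i=1..n. int (digit p (n - i) s) * int p ^ (n - i) * bs i)"

definition afrak :: "nat \<Rightarrow> nat \<Rightarrow> (nat \<Rightarrow> int) \<Rightarrow> int \<Rightarrow> nat" where
  "afrak p n bs t = (THE s. s < p ^ n \<and> (bfrak p n bs s + t) mod (int p ^ n) = 0)"

definition bpar :: "nat \<Rightarrow> nat \<Rightarrow> (nat \<Rightarrow> int) \<Rightarrow> int \<Rightarrow> int" where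
  "bpar p n bs h = (THE b. h \<le> b \<and> b < h + int p ^ n \<and> afrak p n bs b = p ^ n - 1)"

definition dfun :: "nat \<Rightarrow> nat \<Rightarrow> (nat \<Rightarrow> int) \<Rightarrow> int \<Rightarrow> nat \<Rightarrow> int" where
  "dfun p n bs h s = (bfrak p n bs s + bpar p n bs h - h) div (int p ^ n)"

definition wfun :: "nat \<Rightarrow> nat \<Rightarrow> (nat \<Rightarrow> int) \<Rightarrow> int \<Rightarrow> nat \<Rightarrow> int" where
  "wfun p n bs h s = Min {dfun p n bs h u - dfun p n bs h (u - s) | u. u < p ^ n \<and> preceq p n s u}"

definition Dset :: "nat \<Rightarrow> nat \<Rightarrow> (nat \<Rightarrow> int) \<Rightarrow> int \<Rightarrow> nat set" where
  "Dset p n bs h = {u. u < p ^ n \<and> (\<forall>s < p ^ n. prec p n 0 s \<and> preceq p n s u \<longrightarrow>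
      dfun p n bs h u > dfun p n bs h (u - s) + wfun p n bs h s)}"

definition Eset :: "nat \<Rightarrow> nat \<Rightarrow> (nat \<Rightarrow> int) \<Rightarrow> int \<Rightarrow> nat set" where
  "Eset p n bs h = {u. u < p ^ n \<and> (\<forall>s < p ^ n. prec p n 0 s \<and> prec p n s u \<longrightarrow>
      wfun p n bs h u > wfun p n bs h (u - s) + wfun p n bs h s)}"

definition is_subfield :: "'a::field set \<Rightarrow> bool" where
  "is_subfield K = (0 \<in> K \<and> 1 \<in> K \<and> (\<forall>x\<in>K. \<forall>y\<in>K. x + y \<in> K \<and> x * y \<in> K \<and> - x \<in> K
       \<and> (x \<noteq> 0 \<longrightarrow> inverse x \<in> K)))"

text \<open>Normalized discrete valuation (values on nonzero elements only; v 0 is irrelevant).\<close>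
definition normalized_dv :: "('a::field \<Rightarrow> int) \<Rightarrow> bool" where
  "normalized_dv v = ((\<forall>x y. x \<noteq> 0 \<longrightarrow> y \<noteq> 0 \<longrightarrow> v (x * y) = v x + v y)
     \<and> (\<forall>x y. x \<noteq> 0 \<longrightarrow> y \<noteq> 0 \<longrightarrow> x + y \<noteq> 0 \<longrightarrow> min (v x) (v y) \<le> v (x + y))
     \<and> (\<exists>\<pi>. \<pi> \<noteq> 0 \<and> v \<pi> = 1))"

definition vpow :: "('a::field \<Rightarrow> int) \<Rightarrow> int \<Rightarrow> 'a set" where
  "vpow v h = {x. x = 0 \<or> h \<le> v x}"

definition OK :: "'a::field set \<Rightarrow> ('a \<Rightarrow> int) \<Rightarrow> 'a set" where
  "OK K v = {x \<in> K. x = 0 \<or> 0 \<le> v x}"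

definition PK :: "'a::field set \<Rightarrow> ('a \<Rightarrow> int) \<Rightarrow> 'a set" where
  "PK K v = {x \<in> K. x = 0 \<or> 0 < v x}"

definition complete_wrt :: "'a::field set \<Rightarrow> ('a \<Rightarrow> int) \<Rightarrow> bool" where
  "complete_wrt K v = (\<forall>x::nat \<Rightarrow> 'a. (\<forall>m. x m \<in> K) \<longrightarrow>
      (\<forall>N. \<exists>M. \<forall>i\<ge>M. \<forall>j\<ge>M. x i = x j \<or> N \<le> v (x i - x j)) \<longrightarrow>
      (\<exists>y\<in>K. \<forall>N. \<exists>M. \<forall>i\<ge>M. x i = y \<or> N \<le> v (x i - y)))"

definition has_dim :: "'a::zero set \<Rightarrow> ('a \<Rightarrow> 'v::comm_monoid_add \<Rightarrow> 'v) \<Rightarrow> nat \<Rightarrow> bool" where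
  "has_dim K scal N = (\<exists>f::nat \<Rightarrow> 'v.
      (\<forall>x. \<exists>c. (\<forall>i<N. c i \<in> K) \<and> x = (\<Sum>i<N. scal (c i) (f i)))
    \<and> (\<forall>c. (\<forall>i<N. c i \<in> K) \<longrightarrow> (\<Sum>i<N. scal (c i) (f i)) = 0 \<longrightarrow> (\<forall>i<N. c i = 0)))"

definition K_algebra :: "'a::field set \<Rightarrow> ('a \<Rightarrow> 'b::ring_1) \<Rightarrow> bool" where
  "K_algebra K \<iota> = ((\<forall>x\<in>K. \<forall>y\<in>K. \<iota> (x + y) = \<iota> x + \<iota> y \<and> \<iota> (x * y) = \<iota> x * \<iota> y)
      \<and> \<iota> 1 = 1 \<and> (\<forall>x\<in>K. \<forall>\<alpha>. \<iota> x * \<alpha> = \<alpha> * \<iota> x))"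

text \<open>act makes L an A-module, compatible with the K-structure (hence K-linear).\<close>
definition algebra_action :: "'a::field set \<Rightarrow> ('a \<Rightarrow> 'b::ring_1) \<Rightarrow> ('b \<Rightarrow> 'a \<Rightarrow> 'a) \<Rightarrow> bool" where
  "algebra_action K \<iota> act = ((\<forall>\<alpha> \<beta> x. act (\<alpha> * \<beta>) x = act \<alpha> (act \<beta> x))
      \<and> (\<forall>x. act 1 x = x)
      \<and> (\<forall>\<alpha> \<beta> x. act (\<alpha> + \<beta>) x = act \<alpha> x + act \<beta> x)
      \<and> (\<forall>\<alpha> x y. act \<alpha> (x + y) = act \<alpha> x + act \<alpha> y)
      \<and> (\<forall>c\<in>K. \<forall>x. act (\<iota> c) x = c * x))"

text \<open>The standing setting: K subfield of L, complete; v_L normalized on L;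
  v_L(K^x) = p^n Z (totally ramified, e = p^n); residue char p; [L:K] = p^n;
  A a K-algebra of dimension p^n acting on L.\<close>
definition setting :: "'a::field set \<Rightarrow> ('a \<Rightarrow> int) \<Rightarrow> nat \<Rightarrow> nat \<Rightarrow> ('a \<Rightarrow> 'b::ring_1)
    \<Rightarrow> ('b \<Rightarrow> 'a \<Rightarrow> 'a) \<Rightarrow> bool" where
  "setting K vL p n \<iota> act = (prime p \<and> is_subfield K \<and> normalized_dv vL \<and> complete_wrt K vL
      \<and> {vL x | x. x \<in> K \<and> x \<noteq> 0} = {int p ^ n * k | k. True}
      \<and> of_nat p \<in> PK K vL
      \<and> has_dim K (\<lambda>c x. c * x) (p ^ n)
      \<and> K_algebra K \<iota> \<and> has_dim K (\<lambda>c \<alpha>. \<iota> c * \<alpha>) (p ^ n)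
      \<and> algebra_action K \<iota> act)"

text \<open>y \<equiv> 0 modulo lambda_s P_L^T, i.e. y \<in> lambda_s P_L^T (y = 0 when T = \<infinity>).\<close>
definition tol_zero :: "('a::field \<Rightarrow> int) \<Rightarrow> enat \<Rightarrow> int \<Rightarrow> 'a \<Rightarrow> bool" where
  "tol_zero v T s y = (y = 0 \<or> (case T of enat k \<Rightarrow> s + int k \<le> v y | \<infinity> \<Rightarrow> False))"

definition scaffold :: "'a::field set \<Rightarrow> ('a \<Rightarrow> int) \<Rightarrow> nat \<Rightarrow> nat \<Rightarrow> (nat \<Rightarrow> int)
    \<Rightarrow> ('b::ring_1 \<Rightarrow> 'a \<Rightarrow> 'a) \<Rightarrow> enat \<Rightarrow> (int \<Rightarrow> 'a) \<Rightarrow> (nat \<Rightarrow> 'b) \<Rightarrow> bool" where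
  "scaffold K vL p n bs act T lam Psi = (1 \<le> T
    \<and> (\<forall>t. lam t \<noteq> 0 \<and> vL (lam t) = t)
    \<and> (\<forall>t1 t2. (t1 - t2) mod (int p ^ n) = 0 \<longrightarrow> lam t1 / lam t2 \<in> K)
    \<and> (\<forall>i\<in>{1..n}. act (Psi i) 1 = 0)
    \<and> (\<forall>i\<in>{1..n}. \<forall>t. \<exists>u\<in>K. u \<noteq> 0 \<and> vL u = 0 \<and>
        (if 1 \<le> digit p (n - i) (afrak p n bs t)
         then tol_zero vL T (t + int p ^ (n - i) * bs i)
                (act (Psi i) (lam t) - u * lam (t + int p ^ (n - i) * bs i))
         else tol_zero vL T (t + int p ^ (n - i) * bs i) (act (Psi i) (lam t)))))"

definition assoc_order :: "('b \<Rightarrow> 'a::field \<Rightarrow> 'a) \<Rightarrow> ('a \<Rightarrow> int) \<Rightarrow> int \<Rightarrow> 'b set" where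
  "assoc_order act vL h = {\<alpha>. \<forall>x \<in> vpow vL h. act \<alpha> x \<in> vpow vL h}"

definition generated_by :: "('b \<Rightarrow> 'a \<Rightarrow> 'a::comm_monoid_add) \<Rightarrow> 'b set \<Rightarrow> 'a set \<Rightarrow> nat \<Rightarrow> bool" where
  "generated_by act R M m = (\<exists>g::nat \<Rightarrow> 'a. (\<forall>i<m. g i \<in> M)
      \<and> M = {\<Sum>i<m. act (\<alpha> i) (g i) | \<alpha>. \<forall>i<m. \<alpha> i \<in> R})"

definition is_subring :: "'b::ring_1 set \<Rightarrow> bool" where
  "is_subring R = (0 \<in> R \<and> 1 \<in> R \<and> (\<forall>x\<in>R. \<forall>y\<in>R. x + y \<in> R \<and> x * y \<in> R \<and> - x \<in> R))"

definition left_ideal :: "'b::ring_1 set \<Rightarrow> 'b set \<Rightarrow> bool" where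
  "left_ideal R I = (I \<subseteq> R \<and> 0 \<in> I \<and> (\<forall>x\<in>I. \<forall>y\<in>I. x + y \<in> I \<and> - x \<in> I)
      \<and> (\<forall>r\<in>R. \<forall>x\<in>I. r * x \<in> I))"

definition max_left_ideal :: "'b::ring_1 set \<Rightarrow> 'b set \<Rightarrow> bool" where
  "max_left_ideal R I = (left_ideal R I \<and> I \<noteq> R
      \<and> (\<forall>J. left_ideal R J \<and> I \<subseteq> J \<and> J \<noteq> R \<longrightarrow> J = I))"

definition ideal_sq :: "'b::ring_1 set \<Rightarrow> 'b set" where
  "ideal_sq M = {\<Sum>i<k. x i * y i | (k::nat) x y. \<forall>i<k. x i \<in> M \<and> y i \<in> M}"

text \<open>dim over kappa = O/P (acting through iota) of M/M^2 equals r: there are r elements of M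
  whose classes form a kappa-basis of M/M^2.\<close>
definition kappa_dim_quot :: "('a \<Rightarrow> 'b::ring_1) \<Rightarrow> 'a set \<Rightarrow> 'a set \<Rightarrow> 'b set \<Rightarrow> nat \<Rightarrow> bool" where
  "kappa_dim_quot \<iota> Ok Pk M r = (\<exists>f::nat \<Rightarrow> 'b. (\<forall>i<r. f i \<in> M)
     \<and> (\<forall>\<mu>\<in>M. \<exists>c. (\<forall>i<r. c i \<in> Ok) \<and> \<mu> - (\<Sum>i<r. \<iota> (c i) * f i) \<in> ideal_sq M)
     \<and> (\<forall>c. (\<forall>i<r. c i \<in> Ok) \<longrightarrow> (\<Sum>i<r. \<iota> (c i) * f i) \<in> ideal_sq M \<longrightarrow> (\<forall>i<r. c i \<in> Pk)))"

end

theory Submission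
  imports Defs
begin

text \<open>
  Let \<open>\<pi>\<close> generate \<open>P\<^sub>K\<close>. The elements \<open>f\<^sub>u = \<lambda>\<^bsub>b + \<bb>(u)\<^esub>\<close> have valuations that are distinct modulo
  \<open>p\<^sup>n\<close>, and an ordered monomial \<open>\<Psi>\<^sub>s\<close> in the \<open>\<Psi>\<^sub>i\<close> sends \<open>f\<^sub>u\<close> to a unit multiple of \<open>f\<^bsub>u+s\<^esub>\<close> if \<open>u + s\<close> is
  computed without carries, and to \<open>0\<close> otherwise, up to the tolerance. After rescaling to
  \<open>e\<^sub>u = \<pi>\<^bsup>-d(u)\<^esup> f\<^sub>u\<close> and \<open>\<Phi>\<^sub>s = \<pi>\<^bsup>-w(s)\<^esup> \<Psi>\<^sub>s\<close>, the \<open>e\<^sub>u\<close> are an \<open>O\<^sub>K\<close>-basis of \<open>P\<^sub>L\<^sup>h\<close>, the \<open>\<Phi>\<^sub>s\<close> are an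
  \<open>O\<^sub>K\<close>-basis of the associated order, and modulo \<open>\<pi>\<close> the action is \<open>\<Phi>\<^sub>s e\<^sub>u = \<epsilon> e\<^bsub>u+s\<^esub>\<close> with \<open>\<epsilon>\<close> a unit if
  \<open>w(s) = d(u+s) - d(u)\<close> without carries and \<open>\<epsilon> = 0\<close> otherwise. The action is therefore triangular with
  a constant diagonal, and the diagonal entry is the residue map: its kernel is the maximal ideal
  \<open>M\<close>, spanned by \<open>\<pi>\<close> and the \<open>\<Phi>\<^sub>s\<close> with \<open>s \<noteq> 0\<close>. Modulo \<open>\<pi>\<close> the image of \<open>M\<close> is spanned by the \<open>e\<^sub>u\<close>
  with \<open>u \<notin> D\<close>, and \<open>\<Phi>\<^sub>s \<Phi>\<^sub>t\<close> is a unit multiple of \<open>\<Phi>\<^bsub>s+t\<^esub>\<close> if \<open>w(s+t) = w(s) + w(t)\<close> without carries and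
  \<open>0\<close> otherwise, which gives \<open>M\<^sup>2\<close>. Nakayama's lemma over \<open>O\<^sub>K\<close> does the lifting.
\<close>

section \<open>Digits\<close>

lemma digit_less: "0 < p \<Longrightarrow> digit p j s < p"
  by (simp add: digit_def)

lemma digit_0 [simp]: "digit p j 0 = 0"
  by (simp add: digit_def)

lemma sum_digits_mod: "(\<Sum>j<n. digit p j s * p ^ j) = s mod p ^ n"
proof (induction n)
  case (Suc n)
  have "s mod (p ^ n * p) = p ^ n * (s div p ^ n mod p) + s mod p ^ n"
    by (rule mod_mult2_eq)
  with Suc show ?case by (simp add: digit_def mult.commute)
qed simp

lemma sum_digits: "s < p ^ n \<Longrightarrow> (\<Sum>j<n. digit p j s * p ^ j) = s"
  by (simp add: sum_digits_mod)

lemma sum_powers_less: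
  fixes p :: nat
  assumes "\<And>j. j < n \<Longrightarrow> c j < p"
  shows "(\<Sum>j<n. c j * p ^ j) < p ^ n"
  using assms
proof (induction n)
  case (Suc n)
  then have "(\<Sum>j<n. c j * p ^ j) < p ^ n" "Suc (c n) \<le> p"
    by (auto simp: Suc_le_eq)
  then have "(\<Sum>j<n. c j * p ^ j) + c n * p ^ n < Suc (c n) * p ^ n"
    by simp
  also have "\<dots> \<le> p * p ^ n" using \<open>Suc (c n) \<le> p\<close> by (rule mult_le_mono1)
  finally show ?case by simp
qed simp

lemma digit_sum_powers:
  assumes "\<And>i. i < n \<Longrightarrow> c i < p" "j < n"
  shows "digit p j (\<Sum>i<n. c i * p ^ i) = c j"
  using assms
proof (induction n)
  case (Suc n)
  let ?S = "\<Sum>i<n. c i * p ^ i"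
  have p: "0 < p" using Suc.prems(1)[of n] by simp
  have S: "?S < p ^ n" using Suc.prems by (intro sum_powers_less) auto
  show ?case
  proof (cases "j = n")
    case True
    then show ?thesis using S p Suc.prems(1)[of n] by (simp add: digit_def)
  next
    case False
    then have j: "j < n" using Suc.prems by simp
    then obtain k where k: "n = j + Suc k" using less_iff_Suc_add by auto
    \<comment> \<open>As \<open>j < n\<close>, the top term is still a multiple of \<open>p\<close>
      after division by \<open>p ^ j\<close>, so \<open>digit\<close> does not see it.\<close>
    have "c n * p ^ n = p ^ j * (c n * p ^ k * p)"
      unfolding k power_add power_Suc by (rule mult.left_commute [THEN trans]) (simp only: ac_simps)
    then have "(?S + c n * p ^ n) div p ^ j = c n * p ^ k * p + ?S div p ^ j"
      using p by (metis add.commute div_mult_self2 power_eq_0_iff less_irrefl)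
    then have "digit p j (?S + c n * p ^ n) = digit p j ?S"
      by (simp add: digit_def)
    then show ?thesis using Suc j by simp
  qed
qed simp

lemma digit_power:
  assumes "1 < p"
  shows "digit p j (p ^ i) = (if j = i then 1 else 0)"
proof -
  have "digit p j (\<Sum>k<Suc (i + j). (if k = i then 1 else 0) * p ^ k) = (if j = i then 1 else 0)"
    using assms by (intro digit_sum_powers) auto
  moreover have "(\<Sum>k<Suc (i + j). (if k = i then 1 else 0) * p ^ k) = (\<Sum>k\<in>{i}. p ^ k)"
    by (rule sum.mono_neutral_cong_right) auto
  ultimately show ?thesis by simp
qed

lemma digit_eqI:
  assumes "s < p ^ n" "t < p ^ n" "\<And>j. j < n \<Longrightarrow> digit p j s = digit p j t"
  shows "s = t"
proof -
  have "(\<Sum>j<n. digit p j s * p ^ j) = (\<Sum>j<n. digit p j t * p ^ j)"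
    using assms(3) by (intro sum.cong) auto
  then show ?thesis by (simp only: sum_digits[OF assms(1)] sum_digits[OF assms(2)])
qed

section \<open>Carry-free addition\<close>

definition nocarry :: "nat \<Rightarrow> nat \<Rightarrow> nat \<Rightarrow> nat \<Rightarrow> bool" where
  "nocarry p n s t = (\<forall>j<n. digit p j s + digit p j t < p)"

lemma nocarry_commute: "nocarry p n s t = nocarry p n t s"
  by (simp add: nocarry_def add.commute)

lemma nocarry_0 [simp]: "0 < p \<Longrightarrow> nocarry p n 0 s" "0 < p \<Longrightarrow> nocarry p n s 0"
  by (auto simp: nocarry_def digit_less)

lemma nocarry_add:
  assumes "nocarry p n s t" "s < p ^ n" "t < p ^ n"
  shows nocarry_add_less: "s + t < p ^ n"
    and digit_add: "j < n \<Longrightarrow> digit p j (s + t) = digit p j s + digit p j t"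
proof -
  have eq: "s + t = (\<Sum>i<n. (digit p i s + digit p i t) * p ^ i)"
    using sum_digits[OF assms(2)] sum_digits[OF assms(3)]
    by (simp add: sum.distrib distrib_right)
  show "s + t < p ^ n"
    unfolding eq using assms(1) by (intro sum_powers_less) (auto simp: nocarry_def)
  show "digit p j (s + t) = digit p j s + digit p j t" if "j < n"
    unfolding eq using that assms(1) by (intro digit_sum_powers) (auto simp: nocarry_def)
qed

text \<open>Digit by digit, both sides say that the three digits add up to less than
  \<open>p\<close>. This matches the condition for two successive shifts with that for the total
  shift.\<close>

lemma nocarry_assoc:
  assumes "nocarry p n s t" "s < p ^ n" "t < p ^ n" "u < p ^ n"
  shows "nocarry p n t u \<and> nocarry p n s (u + t) \<longleftrightarrow> nocarry p n (s + t) u"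
proof -
  have "nocarry p n t u" if "nocarry p n (s + t) u"
    using that digit_add[OF assms(1-3)] by (force simp: nocarry_def)
  moreover have "nocarry p n s (u + t) \<longleftrightarrow> nocarry p n (s + t) u" if "nocarry p n t u"
    using digit_add[OF assms(1-3)] digit_add[OF that assms(3,4)]
    by (simp add: nocarry_def algebra_simps)
  ultimately show ?thesis by blast
qed

lemma nocarry_left:
  assumes "nocarry p n t u" "nocarry p n s (u + t)" "t < p ^ n" "u < p ^ n"
  shows "nocarry p n s t"
  using digit_add[OF assms(1,3,4)] assms(2) by (force simp: nocarry_def algebra_simps)

text \<open>Digitwise differences are valid digits, hence the digits of \<open>u - s\<close>. This
  turns the relation \<open>preceq\<close> in \<open>wfun\<close>, \<open>Dset\<close> and
  \<open>Eset\<close> into a carry-free sum \<open>u = s + (u - s)\<close>.\<close>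

lemma preceq_diff:
  assumes "preceq p n s u" "s < p ^ n" "u < p ^ n" "0 < p"
  shows preceq_le: "s \<le> u" and preceq_nocarry: "nocarry p n s (u - s)"
proof -
  let ?r = "\<Sum>i<n. (digit p i u - digit p i s) * p ^ i"
  have less: "digit p i u - digit p i s < p" for i
    using digit_less[OF assms(4), of i u] by simp
  have "s + ?r = (\<Sum>i<n. digit p i s * p ^ i) + ?r"
    by (simp add: sum_digits[OF assms(2)])
  also have "\<dots> = (\<Sum>i<n. digit p i u * p ^ i)"
    unfolding sum.distrib[symmetric] distrib_right[symmetric]
    using assms(1) by (intro sum.cong) (auto simp: preceq_def)
  finally have eq: "u = s + ?r" by (simp add: sum_digits[OF assms(3)])
  then show "s \<le> u" by linarith
  have "digit p j (u - s) = digit p j u - digit p j s" if "j < n" for j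
  proof -
    have "u - s = ?r" using eq by linarith
    then show ?thesis using digit_sum_powers[of n "\<lambda>i. digit p i u - digit p i s" p j] less that by simp
  qed
  then show "nocarry p n s (u - s)"
    using assms(1) digit_less[OF assms(4)] by (auto simp: nocarry_def preceq_def)
qed

lemma nocarry_preceq:
  assumes "nocarry p n s t" "s < p ^ n" "t < p ^ n"
  shows "preceq p n s (s + t)"
  using digit_add[OF assms] by (simp add: preceq_def)

lemma pred_power_eq_sum: "0 < p \<Longrightarrow> (p::nat) ^ n - 1 = (\<Sum>i<n. (p - 1) * p ^ i)"
proof (induction n)
  case (Suc n)
  have "p ^ Suc n = p ^ n + (p - 1) * p ^ n" using Suc.prems by (cases p) simp_all
  moreover have "0 < p ^ n" using Suc.prems by simp
  ultimately have "p ^ Suc n - 1 = (p ^ n - 1) + (p - 1) * p ^ n" by linarith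
  with Suc show ?case by simp
qed simp

text \<open>All digits of \<open>p ^ n - 1\<close> are \<open>p - 1\<close>, so subtracting
  \<open>u\<close> never borrows. These complements will be the values of \<open>afrak\<close> at
  the exponents of the basis.\<close>

lemma digit_complement:
  assumes "0 < p" "u < p ^ n" "j < n"
  shows "digit p j (p ^ n - 1 - u) = p - 1 - digit p j u"
    and "nocarry p n (p ^ n - 1 - u) u"
proof -
  have top: "digit p i (p ^ n - 1) = p - 1" if "i < n" for i
    unfolding pred_power_eq_sum[OF assms(1)] using assms(1) that by (intro digit_sum_powers) auto
  have "preceq p n u (p ^ n - 1)"
    unfolding preceq_def using top digit_less[OF assms(1)]
    by (metis One_nat_def Suc_pred assms(1) less_Suc_eq_le)
  then have nc: "nocarry p n u (p ^ n - 1 - u)"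
    using assms by (intro preceq_nocarry) auto
  then show "nocarry p n (p ^ n - 1 - u) u" by (simp add: nocarry_commute)
  have "digit p j (u + (p ^ n - 1 - u)) = digit p j u + digit p j (p ^ n - 1 - u)"
    using assms by (intro digit_add[OF nc]) auto
  moreover have "u + (p ^ n - 1 - u) = p ^ n - 1" using assms(2) by simp
  ultimately show "digit p j (p ^ n - 1 - u) = p - 1 - digit p j u"
    using top[OF assms(3)] by simp
qed

section \<open>Weights and their residues modulo \<open>p ^ n\<close>\<close>

lemma bfrak_eq: "bfrak p n bs s = (\<Sum>j<n. int (digit p j s) * int p ^ j * bs (n - j))"
  unfolding bfrak_def
  by (rule sum.reindex_bij_witness[where i = "\<lambda>j. n - j" and j = "\<lambda>i. n - i"]) auto

lemma bfrak_0 [simp]: "bfrak p n bs 0 = 0"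
  by (simp add: bfrak_def)

lemma bfrak_add:
  assumes "nocarry p n s t" "s < p ^ n" "t < p ^ n"
  shows "bfrak p n bs (s + t) = bfrak p n bs s + bfrak p n bs t"
  using digit_add[OF assms] by (simp add: bfrak_eq sum.distrib[symmetric] algebra_simps)

lemma bfrak_power:
  assumes "1 < p" "j < n"
  shows "bfrak p n bs (p ^ j) = int p ^ j * bs (n - j)"
proof -
  have "bfrak p n bs (p ^ j) = (\<Sum>i\<in>{j}. int p ^ i * bs (n - i))"
    unfolding bfrak_eq using assms by (intro sum.mono_neutral_cong_right) (auto simp: digit_power)
  then show ?thesis by simp
qed

text \<open>Digits are compared from the lowest up. Modulo \<open>p ^ Suc j\<close> the lower terms
  cancel by induction and the higher ones vanish; the factor \<open>bs (n - j)\<close> of the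
  remaining term is prime to \<open>p\<close>, and digits congruent modulo \<open>p\<close> are
  equal.\<close>

lemma bfrak_inj:
  assumes p: "prime p" and cop: "\<forall>i\<in>{1..n}. coprime (bs i) (int p)"
    and st: "s < p ^ n" "t < p ^ n"
    and dvd: "int p ^ n dvd bfrak p n bs s - bfrak p n bs t"
  shows "s = t"
proof (rule digit_eqI[OF st])
  have p0: "0 < p" using p prime_gt_0_nat by blast
  fix j assume "j < n"
  then show "digit p j s = digit p j t"
  proof (induction j rule: less_induct)
    case (less j)
    define D where "D i = int (digit p i s) - int (digit p i t)" for i
    let ?g = "\<lambda>i. D i * int p ^ i * bs (n - i)"
    have "int p ^ Suc j dvd (\<Sum>i<n. ?g i)"
    proof -
      have "int p ^ n dvd (\<Sum>i<n. ?g i)"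
        using dvd by (simp add: bfrak_eq D_def sum_subtractf[symmetric] algebra_simps)
      then show ?thesis using less.prems power_le_dvd Suc_leI by blast
    qed
    moreover have "(\<Sum>i<n. ?g i) = ?g j + (\<Sum>i\<in>{..<n} - {j}. ?g i)"
      using less.prems by (intro sum.remove) auto
    moreover have "int p ^ Suc j dvd (\<Sum>i\<in>{..<n} - {j}. ?g i)"
    proof (rule dvd_sum)
      fix i assume i: "i \<in> {..<n} - {j}"
      show "int p ^ Suc j dvd ?g i"
      proof (cases "i < j")
        case True
        then have "D i = 0" using less i by (auto simp: D_def)
        then show ?thesis by simp
      next
        case False
        then have "Suc j \<le> i" using i by auto
        then have "int p ^ Suc j dvd int p ^ i" by (rule le_imp_power_dvd)
        then show ?thesis by (metis dvd_mult dvd_mult2 mult.commute)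
      qed
    qed
    ultimately have "int p ^ Suc j dvd ?g j" by (simp only: dvd_add_left_iff)
    then have "int p ^ j * int p dvd int p ^ j * (D j * bs (n - j))"
      by (simp add: algebra_simps)
    then have "int p dvd D j * bs (n - j)"
      using p0 by (subst (asm) dvd_mult_cancel_left) auto
    moreover have "coprime (int p) (bs (n - j))"
      using cop less.prems by (auto simp: coprime_commute)
    ultimately have "int p dvd D j" by (simp add: coprime_dvd_mult_left_iff)
    moreover have "\<bar>D j\<bar> < int p"
      using digit_less[OF p0, of j s] digit_less[OF p0, of j t] by (auto simp: D_def)
    ultimately have "D j = 0" using zdvd_not_zless[of "\<bar>D j\<bar>" "int p"] by fastforce
    then show ?case by (simp add: D_def)
  qed
qed

text \<open>By \<open>bfrak_inj\<close> the residue map is an injection between sets of size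
  \<open>p ^ n\<close>, so it takes the value 0 exactly once. This justifies the description
  operator in \<open>afrak\<close>.\<close>

lemma afrak_ex1:
  assumes p: "prime p" and cop: "\<forall>i\<in>{1..n}. coprime (bs i) (int p)"
  shows "\<exists>!s. s < p ^ n \<and> (bfrak p n bs s + t) mod (int p ^ n) = 0"
proof -
  have q: "0 < int p ^ n" using p prime_gt_0_nat by simp
  let ?F = "\<lambda>s. (bfrak p n bs s + t) mod int p ^ n"
  have inj: "inj_on ?F {..<p ^ n}"
    using bfrak_inj[OF p cop]
    by (intro inj_onI) (auto simp: mod_eq_dvd_iff)
  have "?F ` {..<p ^ n} = {0..<int p ^ n}"
  proof (rule card_subset_eq)
    show "?F ` {..<p ^ n} \<subseteq> {0..<int p ^ n}" using q by auto
    show "card (?F ` {..<p ^ n}) = card {0..<int p ^ n}"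
      using card_image[OF inj] by (simp add: nat_power_eq)
  qed simp
  then have "0 \<in> ?F ` {..<p ^ n}" using q by simp
  then obtain s where s: "s < p ^ n" "?F s = 0" by force
  then show ?thesis using inj_onD[OF inj] by (intro ex1I[of _ s]) auto
qed

lemma afrak_eqI:
  assumes "prime p" "\<forall>i\<in>{1..n}. coprime (bs i) (int p)"
    and "s < p ^ n" "(bfrak p n bs s + t) mod (int p ^ n) = 0"
  shows "afrak p n bs t = s"
  unfolding afrak_def using afrak_ex1[OF assms(1,2), of t] assms(3,4) by (intro the1_equality) auto

lemma bpar_props:
  assumes p: "prime p" and cop: "\<forall>i\<in>{1..n}. coprime (bs i) (int p)"
  shows "h \<le> bpar p n bs h" "bpar p n bs h < h + int p ^ n"
    "(bfrak p n bs (p ^ n - 1) + bpar p n bs h) mod (int p ^ n) = 0"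
proof -
  let ?c = "bfrak p n bs (p ^ n - 1)"
  have q: "0 < int p ^ n" using p prime_gt_0_nat by simp
  have af: "afrak p n bs b = p ^ n - 1 \<longleftrightarrow> (?c + b) mod int p ^ n = 0" for b
  proof
    assume "afrak p n bs b = p ^ n - 1"
    then show "(?c + b) mod int p ^ n = 0"
      using theI'[OF afrak_ex1[OF p cop, of b]] unfolding afrak_def by auto
  next
    assume "(?c + b) mod int p ^ n = 0"
    then show "afrak p n bs b = p ^ n - 1"
      using q by (intro afrak_eqI[OF p cop]) auto
  qed
  \<comment> \<open>The representative of \<open>- ?c\<close> modulo \<open>p ^ n\<close> in the
    window of length \<open>p ^ n\<close> that starts at \<open>h\<close>.\<close>
  define b where "b = h + (- ?c - h) mod int p ^ n"
  have "(?c + b) mod int p ^ n = (?c + h + (- ?c - h) mod int p ^ n) mod int p ^ n"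
    by (simp only: b_def add.assoc)
  also have "\<dots> = 0" by (simp only: mod_add_right_eq) simp
  finally have b3: "(?c + b) mod int p ^ n = 0" .
  have b12: "h \<le> b" "b < h + int p ^ n" using q by (auto simp: b_def)
  have uniq: "b' = b" if "h \<le> b' \<and> b' < h + int p ^ n \<and> (?c + b') mod int p ^ n = 0" for b'
  proof -
    have "int p ^ n dvd (?c + b') - (?c + b)"
      using that b3 by (intro dvd_diff) (auto simp: mod_eq_0_iff_dvd)
    then have "int p ^ n dvd b' - b" by simp
    moreover have "\<bar>b' - b\<bar> < int p ^ n" using that b12 by linarith
    ultimately have "b' - b = 0" using dvd_imp_le_int[of "b' - b" "int p ^ n"] q by fastforce
    then show ?thesis by simp
  qed
  have "\<exists>!b. h \<le> b \<and> b < h + int p ^ n \<and> (?c + b) mod int p ^ n = 0"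
    by (rule ex1I[of _ b]) (intro conjI b12 b3, rule uniq)
  then have "\<exists>!b. h \<le> b \<and> b < h + int p ^ n \<and> afrak p n bs b = p ^ n - 1"
    by (simp only: af)
  from theI'[OF this] have "h \<le> bpar p n bs h \<and> bpar p n bs h < h + int p ^ n \<and>
      afrak p n bs (bpar p n bs h) = p ^ n - 1"
    by (simp only: bpar_def[symmetric])
  then show "h \<le> bpar p n bs h" "bpar p n bs h < h + int p ^ n"
    "(?c + bpar p n bs h) mod (int p ^ n) = 0" by (simp_all only: af)
qed

section \<open>Discrete valuations\<close>

lemma finite_ex_minimum:
  fixes f :: "'i \<Rightarrow> 'k::linorder"
  assumes "finite S" "S \<noteq> {}"
  shows "\<exists>k\<in>S. \<forall>j\<in>S. f k \<le> f j"
  using arg_min_if_finite[OF assms, of f] by (intro bexI[of _ "arg_min_on f S"]) (auto simp: not_less)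

locale dval =
  fixes v :: "'a::field \<Rightarrow> int"
  assumes dv: "normalized_dv v"
begin

lemma v_mult: "x \<noteq> 0 \<Longrightarrow> y \<noteq> 0 \<Longrightarrow> v (x * y) = v x + v y"
  using dv by (simp add: normalized_dv_def)

lemma v_1 [simp]: "v 1 = 0"
  using v_mult[of 1 1] by simp

lemma v_uminus [simp]: "v (- x) = v x"
proof (cases "x = 0")
  case False
  have "v (- 1) = 0" using v_mult[of "- 1" "- 1"] by simp
  then show ?thesis using v_mult[of "- 1" x] False by simp
qed simp

lemma v_inverse: "x \<noteq> 0 \<Longrightarrow> v (inverse x) = - v x"
  using v_mult[of x "inverse x"] by simp

lemma v_divide: "x \<noteq> 0 \<Longrightarrow> y \<noteq> 0 \<Longrightarrow> v (x / y) = v x - v y"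
  by (simp add: divide_inverse v_mult v_inverse)

lemma vpow_0 [simp]: "0 \<in> vpow v m"
  by (simp add: vpow_def)

lemma v_add: "x \<noteq> 0 \<Longrightarrow> y \<noteq> 0 \<Longrightarrow> x + y \<noteq> 0 \<Longrightarrow> min (v x) (v y) \<le> v (x + y)"
  using dv by (simp add: normalized_dv_def)

lemma vpow_add:
  assumes "x \<in> vpow v m" "y \<in> vpow v m"
  shows "x + y \<in> vpow v m"
proof (cases "x = 0 \<or> y = 0 \<or> x + y = 0")
  case False
  then show ?thesis using assms v_add[of x y] by (simp add: vpow_def)
qed (use assms in \<open>auto simp: vpow_def\<close>)

lemma vpow_uminus: "x \<in> vpow v m \<Longrightarrow> - x \<in> vpow v m"
  by (simp add: vpow_def)

lemma vpow_diff: "x \<in> vpow v m \<Longrightarrow> y \<in> vpow v m \<Longrightarrow> x - y \<in> vpow v m"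
  using vpow_add[of x m "- y"] vpow_uminus[of y m] by simp

lemma vpow_sum: "(\<And>i. i \<in> I \<Longrightarrow> f i \<in> vpow v m) \<Longrightarrow> sum f I \<in> vpow v m"
  by (induction I rule: infinite_finite_induct) (auto intro: vpow_add)

lemma vpow_mono: "x \<in> vpow v m \<Longrightarrow> k \<le> m \<Longrightarrow> x \<in> vpow v k"
  by (auto simp: vpow_def)

lemma vpow_mult: "x \<in> vpow v k \<Longrightarrow> y \<in> vpow v m \<Longrightarrow> x * y \<in> vpow v (k + m)"
  by (cases "x = 0 \<or> y = 0") (auto simp: vpow_def v_mult)

lemma vpow_mult_iff: "c \<noteq> 0 \<Longrightarrow> c * x \<in> vpow v m \<longleftrightarrow> x \<in> vpow v (m - v c)"
  by (cases "x = 0") (auto simp: vpow_def v_mult)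

text \<open>Otherwise a nonzero term of least valuation would have valuation below \<open>m\<close>;
  being alone at that valuation, it would be a difference of elements of larger valuation.\<close>

lemma vpow_sum_distinct:
  assumes fin: "finite I"
    and dist: "\<And>i j. i \<in> I \<Longrightarrow> j \<in> I \<Longrightarrow> i \<noteq> j \<Longrightarrow> y i \<noteq> 0 \<Longrightarrow> y j \<noteq> 0 \<Longrightarrow> v (y i) \<noteq> v (y j)"
    and sum: "sum y I \<in> vpow v m" and i: "i \<in> I"
  shows "y i \<in> vpow v m"
proof (rule ccontr)
  assume ni: "y i \<notin> vpow v m"
  let ?B = "{j \<in> I. y j \<noteq> 0}"
  have iB: "i \<in> ?B" using ni i by auto
  have "\<exists>k\<in>?B. \<forall>j\<in>?B. v (y k) \<le> v (y j)"
    using fin iB by (intro finite_ex_minimum) auto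
  then obtain k where k: "k \<in> ?B" "\<And>j. j \<in> ?B \<Longrightarrow> v (y k) \<le> v (y j)" by blast
  have km: "v (y k) < m" using k(2)[OF iB] ni iB by (auto simp: vpow_def)
  have "y j \<in> vpow v (v (y k) + 1)" if "j \<in> I - {k}" for j
  proof (cases "y j = 0")
    case False
    then have "v (y j) \<noteq> v (y k)" "v (y k) \<le> v (y j)" using dist[of j k] k that by auto
    then show ?thesis by (simp add: vpow_def)
  qed simp
  then have "sum y (I - {k}) \<in> vpow v (v (y k) + 1)" by (rule vpow_sum)
  moreover have "sum y I \<in> vpow v (v (y k) + 1)" using sum km by (auto intro: vpow_mono)
  moreover have "sum y I = y k + sum y (I - {k})" using k fin by (intro sum.remove) auto
  ultimately have "y k \<in> vpow v (v (y k) + 1)"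
    using vpow_diff[of "sum y I" "v (y k) + 1" "sum y (I - {k})"] by simp
  then show False using k by (auto simp: vpow_def)
qed

end

section \<open>Linear algebra over a subfield\<close>

locale subfield =
  fixes K :: "'a::field set"
  assumes subf: "is_subfield K"
begin

lemma K_0 [simp]: "0 \<in> K" and K_1 [simp]: "1 \<in> K"
  and K_add: "x \<in> K \<Longrightarrow> y \<in> K \<Longrightarrow> x + y \<in> K"
  and K_mult: "x \<in> K \<Longrightarrow> y \<in> K \<Longrightarrow> x * y \<in> K"
  and K_uminus: "x \<in> K \<Longrightarrow> - x \<in> K"
  using subf by (auto simp: is_subfield_def)

lemma K_inverse: "x \<in> K \<Longrightarrow> inverse x \<in> K"
  using subf by (cases "x = 0") (auto simp: is_subfield_def)

lemma K_diff: "x \<in> K \<Longrightarrow> y \<in> K \<Longrightarrow> x - y \<in> K"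
  using K_add[of x "- y"] K_uminus by simp

lemma K_divide: "x \<in> K \<Longrightarrow> y \<in> K \<Longrightarrow> x / y \<in> K"
  by (simp add: divide_inverse K_mult K_inverse)

lemma K_sum: "(\<And>i. i \<in> I \<Longrightarrow> f i \<in> K) \<Longrightarrow> sum f I \<in> K"
  by (induction I rule: infinite_finite_induct) (auto intro: K_add)

lemmas K_closed = K_0 K_1 K_add K_mult K_uminus K_inverse K_diff K_divide

text \<open>Elimination: an unknown with nonzero coefficient in the last equation is solved for and
  substituted, which leaves one unknown and one equation fewer.\<close>

lemma homogeneous_solution:
  fixes a :: "'i \<Rightarrow> nat \<Rightarrow> 'a"
  assumes "finite I" "m < card I" "\<And>i j. i \<in> I \<Longrightarrow> j < m \<Longrightarrow> a i j \<in> K"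
  shows "\<exists>x. (\<forall>i\<in>I. x i \<in> K) \<and> (\<exists>i\<in>I. x i \<noteq> 0) \<and> (\<forall>j<m. (\<Sum>i\<in>I. x i * a i j) = 0)"
  using assms
proof (induction m arbitrary: I a)
  case 0
  then have "I \<noteq> {}" by auto
  then show ?case by (intro exI[of _ "\<lambda>_. 1"]) auto
next
  case (Suc m)
  show ?case
  proof (cases "\<forall>i\<in>I. a i m = 0")
    case True
    have "\<exists>x. (\<forall>i\<in>I. x i \<in> K) \<and> (\<exists>i\<in>I. x i \<noteq> 0) \<and> (\<forall>j<m. (\<Sum>i\<in>I. x i * a i j) = 0)"
      using Suc.prems by (intro Suc.IH) auto
    then show ?thesis using True by (auto simp: less_Suc_eq)
  next
    case False
    then obtain k where k: "k \<in> I" "a k m \<noteq> 0" by auto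
    let ?I = "I - {k}"
    define a' where "a' i j = a i j - a i m / a k m * a k j" for i j
    have "\<exists>x. (\<forall>i\<in>?I. x i \<in> K) \<and> (\<exists>i\<in>?I. x i \<noteq> 0) \<and> (\<forall>j<m. (\<Sum>i\<in>?I. x i * a' i j) = 0)"
      using Suc.prems k by (intro Suc.IH) (auto simp: a'_def intro!: K_closed)
    then obtain x where x: "\<forall>i\<in>?I. x i \<in> K" "\<exists>i\<in>?I. x i \<noteq> 0"
      "\<forall>j<m. (\<Sum>i\<in>?I. x i * a' i j) = 0" by blast
    \<comment> \<open>The value that equation \<open>m\<close> forces on the eliminated unknown
      \<open>k\<close>.\<close>
    define c where "c = - (\<Sum>i\<in>?I. x i * a i m / a k m)"
    define y where "y = x(k := c)"
    have split: "(\<Sum>i\<in>I. y i * a i j) = (\<Sum>i\<in>?I. x i * a' i j)" for j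
    proof -
      have "(\<Sum>i\<in>I. y i * a i j) = c * a k j + (\<Sum>i\<in>?I. y i * a i j)"
        using Suc.prems(1) k(1) by (subst sum.remove[of I k]) (auto simp: y_def)
      also have "(\<Sum>i\<in>?I. y i * a i j) = (\<Sum>i\<in>?I. x i * a i j)"
        by (intro sum.cong) (auto simp: y_def)
      also have "c * a k j = (\<Sum>i\<in>?I. - (x i * a i m / a k m * a k j))"
        by (simp add: c_def sum_distrib_right sum_negf)
      finally show ?thesis
        by (simp add: a'_def sum.distrib[symmetric] algebra_simps)
    qed
    have "c \<in> K" unfolding c_def using x(1) Suc.prems k by (intro K_uminus K_sum K_divide K_mult) auto
    then have "\<forall>i\<in>I. y i \<in> K" using x(1) by (auto simp: y_def)
    moreover have "\<exists>i\<in>I. y i \<noteq> 0" using x(2) by (auto simp: y_def)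
    moreover have "(\<Sum>i\<in>I. y i * a i j) = 0" if "j < Suc m" for j
    proof (cases "j = m")
      case True
      then show ?thesis unfolding split using k by (simp add: a'_def)
    qed (use that x(3) split in auto)
    ultimately show ?thesis by blast
  qed
qed

end

text \<open>One interface for two spaces over \<open>K\<close>: \<open>L\<close> under
  multiplication and \<open>A\<close> under \<open>\<iota>\<close>. The laws are restricted to
  scalars in \<open>K\<close> because \<open>\<iota>\<close> is unconstrained elsewhere.\<close>

locale kmod = subfield K for K :: "'a::field set" +
  fixes scal :: "'a \<Rightarrow> 'v::ab_group_add \<Rightarrow> 'v"
  assumes scal_add_right: "c \<in> K \<Longrightarrow> scal c (x + y) = scal c x + scal c y"
    and scal_add_left: "c \<in> K \<Longrightarrow> d \<in> K \<Longrightarrow> scal (c + d) x = scal c x + scal d x"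
    and scal_scal: "c \<in> K \<Longrightarrow> d \<in> K \<Longrightarrow> scal c (scal d x) = scal (c * d) x"
    and scal_1 [simp]: "scal 1 x = x"
begin

lemma scal_0_right [simp]: "c \<in> K \<Longrightarrow> scal c 0 = 0"
  using scal_add_right[of c 0 0] by simp

lemma scal_0_left [simp]: "scal 0 x = 0"
  using scal_add_left[of 0 0 x] by simp

lemma scal_uminus_left: "c \<in> K \<Longrightarrow> scal (- c) x = - scal c x"
  using scal_add_left[of c "- c" x] K_uminus[of c] by (simp add: eq_neg_iff_add_eq_0 add.commute)

lemma scal_sum_right: "c \<in> K \<Longrightarrow> scal c (\<Sum>i\<in>I. f i) = (\<Sum>i\<in>I. scal c (f i))"
  by (induction I rule: infinite_finite_induct) (auto simp: scal_add_right)

lemma scal_sum_left: "(\<And>i. i \<in> I \<Longrightarrow> c i \<in> K) \<Longrightarrow> scal (\<Sum>i\<in>I. c i) x = (\<Sum>i\<in>I. scal (c i) x)"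
  by (induction I rule: infinite_finite_induct) (auto simp: scal_add_left K_sum)

definition kindep :: "nat \<Rightarrow> (nat \<Rightarrow> 'v) \<Rightarrow> bool" where
  "kindep N g = (\<forall>c. (\<forall>i<N. c i \<in> K) \<longrightarrow> (\<Sum>i<N. scal (c i) (g i)) = 0 \<longrightarrow> (\<forall>i<N. c i = 0))"

lemma kindepD:
  assumes "kindep N g" "\<And>i. i < N \<Longrightarrow> c i \<in> K" "(\<Sum>i<N. scal (c i) (g i)) = 0" "j < N"
  shows "c j = 0"
proof -
  have "(\<forall>i<N. c i \<in> K) \<longrightarrow> (\<Sum>i<N. scal (c i) (g i)) = 0 \<longrightarrow> (\<forall>i<N. c i = 0)"
    using assms(1) unfolding kindep_def by (rule spec)
  then show ?thesis using assms(2-4) by simp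
qed

definition kbasis :: "nat \<Rightarrow> (nat \<Rightarrow> 'v) \<Rightarrow> bool" where
  "kbasis N g = ((\<forall>x. \<exists>c. (\<forall>i<N. c i \<in> K) \<and> x = (\<Sum>i<N. scal (c i) (g i))) \<and> kindep N g)"

text \<open>The family \<open>g\<close> together with \<open>x\<close> consists of
  \<open>N + 1\<close> vectors with \<open>N\<close> coordinates each, so a nontrivial relation
  exists. Independence of \<open>g\<close> makes the coefficient of \<open>x\<close> nonzero, and
  the relation is solved for \<open>x\<close>.\<close>

lemma kindep_kbasis:
  assumes "has_dim K scal N" "kindep N g"
  shows "kbasis N g"
  unfolding kbasis_def
proof (intro conjI allI)
  fix x
  from assms(1) obtain f where f: "\<And>x. \<exists>c. (\<forall>i<N. c i \<in> K) \<and> x = (\<Sum>i<N. scal (c i) (f i))"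
    unfolding has_dim_def by blast
  define g' where "g' = g(N := x)"
  have "\<forall>i. \<exists>c. (\<forall>j<N. c j \<in> K) \<and> g' i = (\<Sum>j<N. scal (c j) (f j))"
    using f by (intro allI)
  from choice[OF this] obtain a where
    a: "\<And>i. (\<forall>j<N. a i j \<in> K) \<and> g' i = (\<Sum>j<N. scal (a i j) (f j))" by blast
  have "\<exists>y. (\<forall>i\<in>{..N}. y i \<in> K) \<and> (\<exists>i\<in>{..N}. y i \<noteq> 0) \<and> (\<forall>j<N. (\<Sum>i\<in>{..N}. y i * a i j) = 0)"
    using a by (intro homogeneous_solution) auto
  then obtain y where y: "\<And>i. i \<le> N \<Longrightarrow> y i \<in> K" "\<exists>i\<le>N. y i \<noteq> 0"
    "\<And>j. j < N \<Longrightarrow> (\<Sum>i\<le>N. y i * a i j) = 0" by auto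
  have "(\<Sum>i\<le>N. scal (y i) (g' i)) = (\<Sum>i\<le>N. \<Sum>j<N. scal (y i * a i j) (f j))"
    using a y(1) by (intro sum.cong refl) (simp add: scal_sum_right scal_scal)
  also have "\<dots> = (\<Sum>j<N. \<Sum>i\<le>N. scal (y i * a i j) (f j))" by (rule sum.swap)
  also have "\<dots> = (\<Sum>j<N. scal (\<Sum>i\<le>N. y i * a i j) (f j))"
    using a y(1) by (intro sum.cong refl scal_sum_left[symmetric]) (auto intro: K_mult)
  also have "\<dots> = 0" using y(3) by simp
  finally have "(\<Sum>i\<le>N. scal (y i) (g' i)) = 0" .
  moreover have "(\<Sum>i\<le>N. scal (y i) (g' i)) = (\<Sum>i<N. scal (y i) (g i)) + scal (y N) x"
    by (simp add: g'_def lessThan_Suc_atMost[symmetric])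
  ultimately have rel: "(\<Sum>i<N. scal (y i) (g i)) + scal (y N) x = 0" by simp
  have yN: "y N \<noteq> 0"
  proof
    assume "y N = 0"
    then have "\<forall>i<N. y i = 0" using assms(2) rel y(1) unfolding kindep_def by simp
    then show False using y(2) \<open>y N = 0\<close> by (metis le_neq_implies_less)
  qed
  have yK: "y i \<in> K" if "i \<le> N" for i using y(1) that by blast
  let ?r = "- inverse (y N)"
  have r: "?r \<in> K" using yK[of N] by (auto intro: K_closed)
  have "x = scal ?r (scal (- y N) x)"
    using r yK[of N] yN by (simp add: scal_scal K_uminus)
  also have "scal (- y N) x = (\<Sum>i<N. scal (y i) (g i))"
    using rel yK[of N] by (simp add: scal_uminus_left neg_eq_iff_add_eq_0 add.commute)
  also have "scal ?r \<dots> = (\<Sum>i<N. scal (?r * y i) (g i))"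
    unfolding scal_sum_right[OF r] using r yK by (intro sum.cong refl scal_scal) auto
  finally have "x = (\<Sum>i<N. scal (?r * y i) (g i))" .
  then show "\<exists>c. (\<forall>i<N. c i \<in> K) \<and> x = (\<Sum>i<N. scal (c i) (g i))"
    using r yK by (intro exI[of _ "\<lambda>i. ?r * y i"] conjI allI impI K_mult) auto
qed (rule assms(2))

text \<open>For a basis the choice is determined at the indices below \<open>N\<close>; the other
  values are arbitrary.\<close>

definition coord :: "nat \<Rightarrow> (nat \<Rightarrow> 'v) \<Rightarrow> 'v \<Rightarrow> nat \<Rightarrow> 'a" where
  "coord N g x = (SOME c. (\<forall>i<N. c i \<in> K) \<and> x = (\<Sum>i<N. scal (c i) (g i)))"

context
  fixes N g assumes basis: "kbasis N g"
begin

lemma coord_in_K: "i < N \<Longrightarrow> coord N g x i \<in> K"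
  and coord_sum: "(\<Sum>i<N. scal (coord N g x i) (g i)) = x"
proof -
  have "\<exists>c. (\<forall>i<N. c i \<in> K) \<and> x = (\<Sum>i<N. scal (c i) (g i))"
    using basis by (simp add: kbasis_def)
  from someI_ex[OF this] show "i < N \<Longrightarrow> coord N g x i \<in> K"
    "(\<Sum>i<N. scal (coord N g x i) (g i)) = x"
    by (simp_all add: coord_def)
qed

lemma coord_unique:
  assumes "\<And>i. i < N \<Longrightarrow> c i \<in> K" "x = (\<Sum>i<N. scal (c i) (g i))" "j < N"
  shows "coord N g x j = c j"
proof -
  let ?d = "\<lambda>i. coord N g x i - c i"
  have "(\<Sum>i<N. scal (?d i) (g i)) = (\<Sum>i<N. scal (coord N g x i) (g i) - scal (c i) (g i))"
  proof (intro sum.cong refl)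
    fix i assume "i \<in> {..<N}"
    then have "coord N g x i \<in> K" "c i \<in> K" using assms(1) coord_in_K by auto
    then show "scal (?d i) (g i) = scal (coord N g x i) (g i) - scal (c i) (g i)"
      using scal_add_left[of "coord N g x i" "- c i"] by (simp add: scal_uminus_left K_uminus)
  qed
  also have "\<dots> = 0" using assms(2) coord_sum[of x] by (simp add: sum_subtractf)
  finally have rel: "(\<Sum>i<N. scal (?d i) (g i)) = 0" .
  have "kindep N g" using basis by (simp add: kbasis_def)
  from kindepD[OF this _ rel assms(3)] have "?d j = 0"
    using assms(1) coord_in_K by (simp add: K_diff)
  then show ?thesis by simp
qed

lemma coord_add: "j < N \<Longrightarrow> coord N g (x + y) j = coord N g x j + coord N g y j"
  using coord_sum[of x] coord_sum[of y] coord_in_K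
  by (intro coord_unique) (auto simp: scal_add_left K_add sum.distrib)

lemma coord_scal: "a \<in> K \<Longrightarrow> j < N \<Longrightarrow> coord N g (scal a x) j = a * coord N g x j"
  using coord_in_K
  by (intro coord_unique)
     (auto simp: K_mult scal_scal[symmetric] scal_sum_right[symmetric] coord_sum)

lemma coord_0: "j < N \<Longrightarrow> coord N g 0 j = 0"
  using coord_scal[of 0 j 0] by simp

lemma coord_sum_fun: "j < N \<Longrightarrow> coord N g (\<Sum>i\<in>I. f i) j = (\<Sum>i\<in>I. coord N g (f i) j)"
  by (induction I rule: infinite_finite_induct) (auto simp: coord_0 coord_add)

lemma coord_diff: "j < N \<Longrightarrow> coord N g (x - y) j = coord N g x j - coord N g y j"
  using coord_add[of j "x - y" y] by simp

lemma coord_basis: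
  assumes "k < N" "j < N"
  shows "coord N g (g k) j = (if j = k then 1 else 0)"
proof -
  have "(\<Sum>i<N. scal (if i = k then 1 else 0) (g i)) = (\<Sum>i\<in>{k}. g i)"
    using assms by (intro sum.mono_neutral_cong_right) auto
  then show ?thesis using assms by (intro coord_unique) auto
qed

end

end

section \<open>Modules over the valuation ring\<close>

locale valued_kmod = dval v + kmod K scal
  for v :: "'a::field \<Rightarrow> int" and K :: "'a set" and scal :: "'a \<Rightarrow> 'v::ab_group_add \<Rightarrow> 'v"

locale valued_subfield = dval v + subfield K for v :: "'a::field \<Rightarrow> int" and K :: "'a set"
begin

lemma OK_eq: "OK K v = K \<inter> vpow v 0" and PK_eq: "PK K v = K \<inter> vpow v 1"
  by (auto simp: OK_def PK_def vpow_def)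

lemma OK_K: "x \<in> OK K v \<Longrightarrow> x \<in> K" and PK_OK: "x \<in> PK K v \<Longrightarrow> x \<in> OK K v"
  by (auto simp: OK_def PK_def)

lemma OK_0 [simp]: "0 \<in> OK K v" and OK_1 [simp]: "1 \<in> OK K v"
  and PK_0 [simp]: "0 \<in> PK K v" and PK_1 [simp]: "1 \<notin> PK K v"
  by (auto simp: OK_def PK_def)

lemma OK_diff: "x \<in> OK K v \<Longrightarrow> y \<in> OK K v \<Longrightarrow> x - y \<in> OK K v"
  and OK_mult: "x \<in> OK K v \<Longrightarrow> y \<in> OK K v \<Longrightarrow> x * y \<in> OK K v"
  and OK_uminus: "x \<in> OK K v \<Longrightarrow> - x \<in> OK K v"
  and PK_add: "x \<in> PK K v \<Longrightarrow> y \<in> PK K v \<Longrightarrow> x + y \<in> PK K v"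
  and PK_diff: "x \<in> PK K v \<Longrightarrow> y \<in> PK K v \<Longrightarrow> x - y \<in> PK K v"
  and PK_uminus: "x \<in> PK K v \<Longrightarrow> - x \<in> PK K v"
  and PK_mult_left: "x \<in> OK K v \<Longrightarrow> y \<in> PK K v \<Longrightarrow> x * y \<in> PK K v"
  and PK_mult_right: "x \<in> PK K v \<Longrightarrow> y \<in> OK K v \<Longrightarrow> x * y \<in> PK K v"
  using vpow_mult[of x 0 y 0] vpow_mult[of x 0 y 1] vpow_mult[of x 1 y 0]
  by (auto simp: OK_eq PK_eq K_closed vpow_add vpow_diff vpow_uminus)

lemma PK_sum: "(\<And>i. i \<in> I \<Longrightarrow> f i \<in> PK K v) \<Longrightarrow> sum f I \<in> PK K v"
  by (auto simp: PK_eq intro!: K_sum vpow_sum)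

lemma unit_nonzero: "x \<notin> PK K v \<Longrightarrow> x \<noteq> 0"
  by auto

lemma unit_inverse: "x \<in> OK K v \<Longrightarrow> x \<notin> PK K v \<Longrightarrow> inverse x \<in> OK K v"
  by (auto simp: OK_def PK_def v_inverse K_inverse)

lemma nonintegral_inverse: "x \<in> K \<Longrightarrow> x \<notin> OK K v \<Longrightarrow> x \<noteq> 0 \<and> inverse x \<in> PK K v"
  by (auto simp: OK_def PK_def v_inverse K_inverse)

lemma unit_mult: "x \<in> OK K v \<Longrightarrow> y \<in> OK K v \<Longrightarrow> x \<notin> PK K v \<Longrightarrow> y \<notin> PK K v \<Longrightarrow> x * y \<notin> PK K v"
  by (auto simp: OK_def PK_def v_mult)

lemma PK_cong: "x - y \<in> PK K v \<Longrightarrow> x \<in> PK K v \<longleftrightarrow> y \<in> PK K v"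
  using PK_add[of "x - y" y] PK_diff[of x "x - y"] by auto

lemma sum_single_cong:
  assumes "finite I" "k \<in> I" "\<And>i. i \<in> I \<Longrightarrow> i \<noteq> k \<Longrightarrow> f i \<in> PK K v" "f k - y \<in> PK K v"
  shows "sum f I - y \<in> PK K v"
proof -
  have "sum f I - y = sum f (I - {k}) + (f k - y)"
    using sum.remove[OF assms(1,2), of f] by simp
  moreover have "sum f (I - {k}) \<in> PK K v" using assms by (intro PK_sum) auto
  ultimately show ?thesis using assms(4) by (simp only: PK_add)
qed

text \<open>Dividing a nonzero solution by an entry of least valuation makes it integral with one
  entry 1. It is then nontrivial modulo \<open>PK\<close>, without any passage to the residue
  field.\<close>

lemma unit_solution:
  fixes a :: "'i \<Rightarrow> nat \<Rightarrow> 'a"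
  assumes fin: "finite I" and "m < card I" "\<And>i j. i \<in> I \<Longrightarrow> j < m \<Longrightarrow> a i j \<in> K"
  shows "\<exists>x. (\<forall>i\<in>I. x i \<in> OK K v) \<and> (\<exists>i\<in>I. x i \<notin> PK K v) \<and> (\<forall>j<m. (\<Sum>i\<in>I. x i * a i j) = 0)"
proof -
  obtain x where x: "\<forall>i\<in>I. x i \<in> K" "\<exists>i\<in>I. x i \<noteq> 0" "\<forall>j<m. (\<Sum>i\<in>I. x i * a i j) = 0"
    using homogeneous_solution[OF fin assms(2), of a] assms(3) by blast
  let ?B = "{i \<in> I. x i \<noteq> 0}"
  have "\<exists>k\<in>?B. \<forall>j\<in>?B. v (x k) \<le> v (x j)"
    using fin x(2) by (intro finite_ex_minimum) auto
  then obtain k where k: "k \<in> ?B" "\<And>j. j \<in> ?B \<Longrightarrow> v (x k) \<le> v (x j)" by blast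
  define y where "y i = x i / x k" for i
  have "y i \<in> OK K v" if "i \<in> I" for i
    using k x(1) that by (cases "x i = 0") (auto simp: OK_def y_def K_divide v_divide)
  moreover have "y k \<notin> PK K v" using k by (simp add: y_def)
  moreover have "(\<Sum>i\<in>I. y i * a i j) = 0" if "j < m" for j
  proof -
    have "(\<Sum>i\<in>I. y i * a i j) = (\<Sum>i\<in>I. x i * a i j) / x k"
      by (simp add: y_def sum_divide_distrib)
    then show ?thesis using x(3) that by simp
  qed
  ultimately show ?thesis using k(1) by (intro exI[of _ y]) auto
qed

end

sublocale valued_kmod \<subseteq> valued_subfield v K ..

context valued_kmod
begin

text \<open>Indices are eliminated from the top down: \<open>1 - c k\<close> is a unit, so the
  relation for \<open>e k\<close> can be solved for it and substituted into the others, until only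
  members of \<open>Y\<close> remain.\<close>

lemma nakayama:
  fixes e :: "nat \<Rightarrow> 'v"
  assumes Y0: "0 \<in> Y" and Yadd: "\<And>x y. x \<in> Y \<Longrightarrow> y \<in> Y \<Longrightarrow> x + y \<in> Y"
    and Yscal: "\<And>c x. c \<in> OK K v \<Longrightarrow> x \<in> Y \<Longrightarrow> scal c x \<in> Y"
    and gen: "\<And>i. i < N \<Longrightarrow> \<exists>y\<in>Y. \<exists>c. (\<forall>j<N. c j \<in> PK K v) \<and> e i = y + (\<Sum>j<N. scal (c j) (e j))"
    and i: "i < N"
  shows "e i \<in> Y"
proof -
  have "\<forall>i<N. \<exists>y\<in>Y. \<exists>c. (\<forall>j<k. c j \<in> PK K v) \<and> e i = y + (\<Sum>j<k. scal (c j) (e j))" if "k \<le> N" for k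
    using that
  proof (induction k rule: inc_induct)
    case base
    then show ?case using gen by blast
  next
    case (step k)
    obtain y c where yc: "y \<in> Y" "\<And>j. j < Suc k \<Longrightarrow> c j \<in> PK K v"
      "e k = y + (\<Sum>j<Suc k. scal (c j) (e j))"
      using step by blast
    have cK: "c j \<in> K" if "j < Suc k" for j using yc(2)[OF that] by (blast intro: OK_K PK_OK)
    let ?a = "1 - c k"
    have ck: "c k \<in> PK K v" "c k \<in> K" using yc(2) cK by auto
    have a: "?a \<in> OK K v" "?a \<notin> PK K v"
    proof -
      show "?a \<in> OK K v" using ck PK_OK by (auto intro: OK_diff)
      show "?a \<notin> PK K v" using PK_cong[of 1 ?a] ck by auto
    qed
    then have a0: "?a \<noteq> 0" "?a \<in> K" and ia: "inverse ?a \<in> OK K v" "inverse ?a \<in> K"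
      using unit_inverse OK_K by (auto simp: unit_nonzero)
    have "scal ?a (e k) = e k - scal (c k) (e k)"
      using scal_add_left[of 1 "- c k" "e k"] ck by (simp add: scal_uminus_left K_uminus)
    also have "\<dots> = y + (\<Sum>j<k. scal (c j) (e j))"
      by (subst (1) yc(3)) simp
    finally have "scal (inverse ?a) (scal ?a (e k)) = scal (inverse ?a) y
        + (\<Sum>j<k. scal (inverse ?a * c j) (e j))"
      using ia cK by (simp add: scal_add_right scal_sum_right scal_scal)
    then have ek: "e k = scal (inverse ?a) y + (\<Sum>j<k. scal (inverse ?a * c j) (e j))"
      using ia a0 by (simp add: scal_scal)
    show ?case
    proof (intro allI impI)
      fix i assume "i < N"
      then obtain y' c' where yc': "y' \<in> Y" "\<And>j. j < Suc k \<Longrightarrow> c' j \<in> PK K v"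
        "e i = y' + (\<Sum>j<Suc k. scal (c' j) (e j))"
        using step.IH by blast
      have c'K: "c' j \<in> K" if "j < Suc k" for j using yc'(2)[OF that] by (blast intro: OK_K PK_OK)
      let ?c = "\<lambda>j. c' j + c' k * (inverse ?a * c j)"
      have "scal (c' k) (e k) = scal (c' k * inverse ?a) y
          + (\<Sum>j<k. scal (c' k * (inverse ?a * c j)) (e j))"
        using c'K[of k] ia cK
        by (subst ek) (simp add: scal_add_right scal_sum_right scal_scal K_mult)
      then have "e i = (y' + scal (c' k * inverse ?a) y) + (\<Sum>j<k. scal (?c j) (e j))"
        using c'K ia cK by (subst yc'(3)) (simp add: scal_add_left sum.distrib K_mult)
      moreover have "y' + scal (c' k * inverse ?a) y \<in> Y"
        using yc(1) yc' ia by (intro Yadd Yscal OK_mult) (auto intro: PK_OK)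
      moreover have "?c j \<in> PK K v" if "j < k" for j
        using yc(2) yc'(2) ia that by (intro PK_add PK_mult_right OK_mult) (auto intro: PK_OK)
      ultimately show "\<exists>y\<in>Y. \<exists>c. (\<forall>j<k. c j \<in> PK K v) \<and> e i = y + (\<Sum>j<k. scal (c j) (e j))"
        by (intro bexI[of _ "y' + scal (c' k * inverse ?a) y"] exI[of _ ?c]) auto
    qed
  qed
  from this[of 0] i show ?thesis by auto
qed

end

section \<open>Graded bases from a scaffold\<close>

lemma (in dval) v_eq_of_close:
  assumes "x \<noteq> 0" "y - x \<in> vpow v (v x + 1)"
  shows "y \<noteq> 0" "v y = v x"
proof -
  show y0: "y \<noteq> 0"
    using assms by (auto simp: vpow_def)
  have "y \<in> vpow v (v x)"
    using vpow_add[OF vpow_mono[OF assms(2), of "v x"], of x] by (simp add: vpow_def)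
  moreover have "y \<notin> vpow v (v x + 1)"
    using vpow_diff[OF _ assms(2), of y] assms(1) by (auto simp: vpow_def)
  ultimately show "v y = v x" using y0 by (simp add: vpow_def)
qed

locale scaffold_setting =
  fixes K :: "'L::field set" and vL :: "'L \<Rightarrow> int" and p n :: nat
    and \<iota> :: "'L \<Rightarrow> 'A::ring_1" and act :: "'A \<Rightarrow> 'L \<Rightarrow> 'L"
    and bs :: "nat \<Rightarrow> int" and T :: enat and lam :: "int \<Rightarrow> 'L" and Psi :: "nat \<Rightarrow> 'A"
    and h :: int
  assumes setting: "setting K vL p n \<iota> act"
    and cop: "\<forall>i\<in>{1..n}. coprime (bs i) (int p)"
    and scaff: "scaffold K vL p n bs act T lam Psi"
    and tolerance: "enat (nat (int p ^ n + bpar p n bs h - h)) \<le> T"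
begin

lemma prime: "prime p" and K_subfield: "is_subfield K" and vL_dv: "normalized_dv vL"
  and vL_K: "{vL x | x. x \<in> K \<and> x \<noteq> 0} = {int p ^ n * k | k. True}"
  and dim_L: "has_dim K (\<lambda>c x. c * x) (p ^ n)"
  and alg: "K_algebra K \<iota>" and dim_A: "has_dim K (\<lambda>c \<alpha>. \<iota> c * \<alpha>) (p ^ n)"
  and action: "algebra_action K \<iota> act"
  using setting unfolding setting_def by - (elim conjE, assumption)+

lemma lam: "lam t \<noteq> 0 \<and> vL (lam t) = t"
  using scaff unfolding scaffold_def by - (elim conjE, erule spec)

lemma Psi_act_1: "i \<in> {1..n} \<Longrightarrow> act (Psi i) 1 = 0"
  using scaff unfolding scaffold_def by - (elim conjE, erule bspec)

lemma Psi_lam: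
  assumes "i \<in> {1..n}"
  shows "\<exists>u\<in>K. u \<noteq> 0 \<and> vL u = 0 \<and>
        (if 1 \<le> digit p (n - i) (afrak p n bs t)
         then tol_zero vL T (t + int p ^ (n - i) * bs i)
                (act (Psi i) (lam t) - u * lam (t + int p ^ (n - i) * bs i))
         else tol_zero vL T (t + int p ^ (n - i) * bs i) (act (Psi i) (lam t)))"
  using scaff unfolding scaffold_def by - (elim conjE, drule bspec[OF _ assms], erule spec)

sublocale valued_subfield vL K
  by unfold_locales (fact vL_dv, fact K_subfield)

sublocale L: valued_kmod vL K "\<lambda>c x. c * x"
  by unfold_locales (simp_all add: algebra_simps)

lemma iota_add: "x \<in> K \<Longrightarrow> y \<in> K \<Longrightarrow> \<iota> (x + y) = \<iota> x + \<iota> y"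
  and iota_mult: "x \<in> K \<Longrightarrow> y \<in> K \<Longrightarrow> \<iota> (x * y) = \<iota> x * \<iota> y"
  and iota_1 [simp]: "\<iota> 1 = 1"
  and iota_commute: "x \<in> K \<Longrightarrow> \<alpha> * \<iota> x = \<iota> x * \<alpha>"
proof -
  have *: "\<forall>x\<in>K. \<forall>y\<in>K. \<iota> (x + y) = \<iota> x + \<iota> y \<and> \<iota> (x * y) = \<iota> x * \<iota> y" "\<iota> 1 = 1"
    "\<forall>x\<in>K. \<forall>\<alpha>. \<iota> x * \<alpha> = \<alpha> * \<iota> x"
    using alg unfolding K_algebra_def by blast+
  show "x \<in> K \<Longrightarrow> y \<in> K \<Longrightarrow> \<iota> (x + y) = \<iota> x + \<iota> y"
    "x \<in> K \<Longrightarrow> y \<in> K \<Longrightarrow> \<iota> (x * y) = \<iota> x * \<iota> y" "\<iota> 1 = 1"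
    using * by blast+
  show "x \<in> K \<Longrightarrow> \<alpha> * \<iota> x = \<iota> x * \<alpha>" by (rule sym) (use *(3) in blast)
qed

sublocale A: valued_kmod vL K "\<lambda>c \<alpha>. \<iota> c * \<alpha>"
  by unfold_locales (simp_all add: iota_add iota_mult algebra_simps)

lemma act_mult: "act (\<alpha> * \<beta>) x = act \<alpha> (act \<beta> x)"
  and act_1 [simp]: "act 1 x = x"
  and act_add_left: "act (\<alpha> + \<beta>) x = act \<alpha> x + act \<beta> x"
  and act_add_right: "act \<alpha> (x + y) = act \<alpha> x + act \<alpha> y"
  and act_iota: "c \<in> K \<Longrightarrow> act (\<iota> c) x = c * x"
  using action by (simp_all add: algebra_action_def)

lemma act_scal_left: "c \<in> K \<Longrightarrow> act (\<iota> c * \<alpha>) x = c * act \<alpha> x"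
  by (simp add: act_mult act_iota)

lemma act_scal_right:
  assumes "c \<in> K" shows "act \<alpha> (c * x) = c * act \<alpha> x"
proof -
  have "act \<alpha> (c * x) = act (\<alpha> * \<iota> c) x" using assms by (simp add: act_mult act_iota)
  then show ?thesis using assms by (simp add: iota_commute act_scal_left)
qed

lemma act_0_left [simp]: "act 0 x = 0"
  using act_add_left[of 0 0 x] by (simp only: add_0_left add_cancel_right_right)

lemma act_0_right [simp]: "act \<alpha> 0 = 0"
  using act_add_right[of \<alpha> 0 0] by (simp only: add_0_left add_cancel_right_right)

lemma act_diff_left: "act (\<alpha> - \<beta>) x = act \<alpha> x - act \<beta> x"
  using act_add_left[of "\<alpha> - \<beta>" \<beta> x] by simp

lemma act_diff_right: "act \<alpha> (x - y) = act \<alpha> x - act \<alpha> y"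
  using act_add_right[of \<alpha> "x - y" y] by simp

lemma act_sum_left: "act (\<Sum>i\<in>I. \<alpha> i) x = (\<Sum>i\<in>I. act (\<alpha> i) x)"
  by (induction I rule: infinite_finite_induct) (simp_all add: act_add_left)

lemma act_sum_right: "act \<alpha> (\<Sum>i\<in>I. x i) = (\<Sum>i\<in>I. act \<alpha> (x i))"
  by (induction I rule: infinite_finite_induct) (simp_all add: act_add_right)

definition q :: nat where "q = p ^ n"
definition Q :: int where "Q = int p ^ n"
definition bp :: int where "bp = bpar p n bs h"

abbreviation "B \<equiv> bfrak p n bs"
abbreviation "nc \<equiv> nocarry p n"
abbreviation "d \<equiv> dfun p n bs h"
abbreviation "w \<equiv> wfun p n bs h"

lemma p_gt_1: "1 < p" and p_pos: "0 < p"
  using prime prime_gt_1_nat prime_gt_0_nat by auto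

lemma Q_pos: "0 < Q" and q_pos: "0 < q"
  using p_pos by (simp_all add: q_def Q_def)

lemma bp_bounds: "h \<le> bp" "bp < h + Q" and bp_mod: "(B (q - 1) + bp) mod Q = 0"
  using bpar_props[OF prime cop, of h] by (simp_all add: bp_def Q_def q_def)

lemma B_inj: "s < q \<Longrightarrow> t < q \<Longrightarrow> Q dvd B s - B t \<Longrightarrow> s = t"
  unfolding q_def Q_def by (rule bfrak_inj[OF prime cop])

lemma B_add: "nc s t \<Longrightarrow> s < q \<Longrightarrow> t < q \<Longrightarrow> B (s + t) = B s + B t"
  unfolding q_def by (rule bfrak_add)

lemma B_add': "nc s t \<Longrightarrow> s < q \<Longrightarrow> t < q \<Longrightarrow> B (t + s) = B t + B s"
  using B_add[of s t] by (simp add: add.commute)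

lemma nc_less: "nc s t \<Longrightarrow> s < q \<Longrightarrow> t < q \<Longrightarrow> s + t < q"
  unfolding q_def by (rule nocarry_add_less)

lemma K_val: "x \<in> K \<Longrightarrow> x \<noteq> 0 \<Longrightarrow> \<exists>k. vL x = Q * k"
  using vL_K unfolding Q_def by blast

lemma K_val_ex: "\<exists>x. x \<in> K \<and> x \<noteq> 0 \<and> vL x = Q * k"
proof -
  have "Q * k \<in> {vL x | x. x \<in> K \<and> x \<noteq> 0}" unfolding vL_K Q_def by blast
  then show ?thesis by auto
qed

text \<open>Some element of \<open>K\<close> of valuation \<open>k\<close> with respect to \<open>K\<close>; it plays the role of \<open>\<pi>\<^sup>k\<close>, which matters
  only up to units.\<close>
definition pw :: "int \<Rightarrow> 'L" where
  "pw k = (if k = 0 then 1 else SOME x. x \<in> K \<and> x \<noteq> 0 \<and> vL x = Q * k)"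

lemma pw_K: "pw k \<in> K" and pw_nonzero: "pw k \<noteq> 0" and v_pw: "vL (pw k) = Q * k"
  using someI_ex[OF K_val_ex[of k]] by (simp_all add: pw_def)

lemma pw_0: "pw 0 = 1"
  by (simp add: pw_def)

definition f :: "nat \<Rightarrow> 'L" where "f u = lam (bp + B u)"

lemma f_nonzero: "f u \<noteq> 0" and v_f: "vL (f u) = bp + B u"
  using lam by (simp_all add: f_def)

context
  fixes g :: "nat \<Rightarrow> 'L"
  assumes g: "\<And>u. u < q \<Longrightarrow> g u \<noteq> 0 \<and> Q dvd vL (g u) - (bp + B u)"
begin

text \<open>Valuations from \<open>K\<close> are multiples of \<open>Q\<close>, and the numbers
  \<open>bp + B u\<close> are pairwise incongruent modulo \<open>Q\<close>, so the nonzero terms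
  have distinct valuations. The valuation of \<open>g\<close> is prescribed only modulo
  \<open>Q\<close>, which also covers rescaled families.\<close>

lemma graded_sum_vpow:
  assumes "\<And>u. u < q \<Longrightarrow> c u \<in> K" "(\<Sum>u<q. c u * g u) \<in> vpow vL m" "u < q"
  shows "c u * g u \<in> vpow vL m"
proof (rule vpow_sum_distinct[of "{..<q}" "\<lambda>u. c u * g u"])
  fix i j assume ij: "i \<in> {..<q}" "j \<in> {..<q}" "i \<noteq> j" "c i * g i \<noteq> 0" "c j * g j \<noteq> 0"
  show "vL (c i * g i) \<noteq> vL (c j * g j)"
  proof
    assume eq: "vL (c i * g i) = vL (c j * g j)"
    obtain k where k: "vL (c i) = Q * k" using K_val[of "c i"] assms(1)[of i] ij by auto
    obtain l where l: "vL (c j) = Q * l" using K_val[of "c j"] assms(1)[of j] ij by auto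
    obtain a where a: "vL (g i) - (bp + B i) = Q * a" using g[of i] ij(1) by (auto elim: dvdE)
    obtain b where b: "vL (g j) - (bp + B j) = Q * b" using g[of j] ij(2) by (auto elim: dvdE)
    have "Q * k + vL (g i) = Q * l + vL (g j)" using eq ij k l by (simp add: v_mult)
    then have "B i - B j = Q * (l + b - k - a)" using a b by (simp add: algebra_simps)
    then have "Q dvd B i - B j" by simp
    then show False using B_inj[of i j] ij by simp
  qed
qed (use assms in auto)

lemma graded_kindep: "L.kindep q g"
  unfolding L.kindep_def
proof (intro allI impI)
  fix c u assume c: "\<forall>u<q. c u \<in> K" "(\<Sum>u<q. c u * g u) = 0" and u: "u < q"
  \<comment> \<open>The zero sum lies in every \<open>vpow\<close>, but a nonzero term cannot lie in
    the one just above its own valuation.\<close>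
  have "c u * g u \<in> vpow vL (vL (c u * g u) + 1)"
    using c u by (intro graded_sum_vpow) auto
  then show "c u = 0" using g[OF u] by (simp add: vpow_def)
qed

lemma graded_kbasis: "L.kbasis q g"
  using L.kindep_kbasis[OF dim_L] graded_kindep by (simp add: q_def)

end

lemma f_basis: "L.kbasis q f"
  by (rule graded_kbasis) (simp add: f_nonzero v_f)

text \<open>\<open>Q + bp - h\<close> is the part of the tolerance that the theorem assumes.\<close>
definition shifts :: "'A \<Rightarrow> nat \<Rightarrow> bool" where
  "shifts \<alpha> s \<longleftrightarrow> (\<forall>u<q. \<exists>c\<in>K. c \<noteq> 0 \<and> vL c = 0 \<and>
     act \<alpha> (f u) - (if nc s u then c * f (u + s) else 0) \<in> vpow vL (bp + B u + B s + (Q + bp - h)))"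

text \<open>In the expansion of \<open>x\<close> in the basis \<open>f\<close> each term lies in
  \<open>vpow vL m\<close> separately, and \<open>\<alpha>\<close> raises the valuation of
  \<open>f u\<close> by at least \<open>B s\<close>, because \<open>Q + bp - h\<close> is
  positive.\<close>

lemma shifts_vpow:
  assumes "shifts \<alpha> s" "s < q" "x \<in> vpow vL m"
  shows "act \<alpha> x \<in> vpow vL (m + B s)"
proof -
  have fu: "act \<alpha> (f u) \<in> vpow vL (bp + B u + B s)" if u: "u < q" for u
  proof -
    obtain c where c: "c \<noteq> 0" "vL c = 0"
      "act \<alpha> (f u) - (if nc s u then c * f (u + s) else 0) \<in> vpow vL (bp + B u + B s + (Q + bp - h))"
      using assms(1) u unfolding shifts_def by blast
    have "act \<alpha> (f u) - (if nc s u then c * f (u + s) else 0) \<in> vpow vL (bp + B u + B s)"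
      using c(3) by (rule vpow_mono) (use bp_bounds Q_pos in linarith)
    moreover have "(if nc s u then c * f (u + s) else 0) \<in> vpow vL (bp + B u + B s)"
      using c B_add'[of s u] assms(2) u by (simp add: vpow_def v_mult f_nonzero v_f)
    ultimately show ?thesis using vpow_add by fastforce
  qed
  let ?c = "L.coord q f x"
  have cK: "?c u \<in> K" if "u < q" for u by (rule L.coord_in_K[OF f_basis that])
  have x: "(\<Sum>u<q. ?c u * f u) = x" by (rule L.coord_sum[OF f_basis])
  have "act \<alpha> x = (\<Sum>u<q. ?c u * act \<alpha> (f u))"
    by (subst x[symmetric]) (simp add: act_sum_right act_scal_right cK)
  also have "\<dots> \<in> vpow vL (m + B s)"
  proof (rule vpow_sum)
    fix u assume "u \<in> {..<q}"
    then have u: "u < q" by simp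
    have "?c u * f u \<in> vpow vL m"
      using assms(3) cK x u
      by (intro graded_sum_vpow[where g = f]) (auto simp: f_nonzero v_f)
    then have "?c u \<in> vpow vL (m - (bp + B u))"
      using vpow_mult_iff[of "f u" "?c u" m] by (simp add: f_nonzero v_f mult.commute)
    from vpow_mult[OF this fu[OF u]] show "?c u * act \<alpha> (f u) \<in> vpow vL (m + B s)"
      by (simp add: algebra_simps)
  qed
  finally show ?thesis .
qed

lemma shifts_1: "shifts 1 0"
  unfolding shifts_def using p_pos by (auto intro!: bexI[of _ 1])

text \<open>Applying \<open>\<alpha>\<close> to the congruence for \<open>\<beta>\<close> moves the
  error by \<open>B s\<close>, so the relative precision is kept. The congruence for
  \<open>\<alpha>\<close> at \<open>u + t\<close> then replaces the main term.\<close>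

lemma shifts_mult:
  assumes \<alpha>: "shifts \<alpha> s" and \<beta>: "shifts \<beta> t" and st: "nc s t" "s < q" "t < q"
  shows "shifts (\<alpha> * \<beta>) (s + t)"
  unfolding shifts_def
proof (intro allI impI)
  fix u assume u: "u < q"
  let ?m = "bp + B u + B (s + t) + (Q + bp - h)"
  have m: "?m = bp + B u + B t + (Q + bp - h) + B s" using B_add[OF st] by simp
  obtain c where c: "c \<in> K" "c \<noteq> 0" "vL c = 0"
    "act \<beta> (f u) - (if nc t u then c * f (u + t) else 0) \<in> vpow vL (bp + B u + B t + (Q + bp - h))"
    using \<beta> u unfolding shifts_def by blast
  from shifts_vpow[OF \<alpha> st(2) c(4)]
  have 1: "act (\<alpha> * \<beta>) (f u) - (if nc t u then c * act \<alpha> (f (u + t)) else 0) \<in> vpow vL ?m"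
    unfolding m using c(1) by (simp add: act_diff_right act_mult act_scal_right split: if_splits)
  have assoc: "nc t u \<and> nc s (u + t) \<longleftrightarrow> nc (s + t) u"
    using nocarry_assoc[OF st(1)] st u by (simp add: q_def)
  show "\<exists>c\<in>K. c \<noteq> 0 \<and> vL c = 0 \<and>
      act (\<alpha> * \<beta>) (f u) - (if nc (s + t) u then c * f (u + (s + t)) else 0) \<in> vpow vL ?m"
  proof (cases "nc t u")
    case False
    then show ?thesis using 1 assoc by (intro bexI[of _ 1]) auto
  next
    case True
    have ut: "u + t < q" using nc_less[OF True st(3) u] by (simp add: add.commute)
    obtain c' where c': "c' \<in> K" "c' \<noteq> 0" "vL c' = 0"
      "act \<alpha> (f (u + t)) - (if nc s (u + t) then c' * f (u + t + s) else 0)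
         \<in> vpow vL (bp + B (u + t) + B s + (Q + bp - h))"
      using \<alpha> ut unfolding shifts_def by blast
    have m': "bp + B (u + t) + B s + (Q + bp - h) = ?m"
      using B_add'[OF True st(3) u] B_add[OF st] by simp
    have "c * (act \<alpha> (f (u + t)) - (if nc s (u + t) then c' * f (u + t + s) else 0)) \<in> vpow vL ?m"
      using c'(4) c(2,3) vpow_mult_iff[OF c(2)] unfolding m' by simp
    from vpow_add[OF this 1] True
    have "act (\<alpha> * \<beta>) (f u) - (if nc s (u + t) then c * c' * f (u + t + s) else 0) \<in> vpow vL ?m"
      by (simp add: algebra_simps split: if_splits)
    then show ?thesis using True assoc c c'
      by (intro bexI[of _ "c * c'"]) (auto simp: v_mult K_mult ac_simps)
  qed
qed

lemma tol_zero_vpow: "tol_zero vL T s y \<Longrightarrow> y \<in> vpow vL (s + (Q + bp - h))"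
  using tolerance unfolding tol_zero_def vpow_def Q_def[symmetric] bp_def[symmetric]
  by (cases T) auto

text \<open>At the exponent of \<open>f u\<close> the value of \<open>afrak\<close> is
  \<open>q - 1 - u\<close>, with digit \<open>p - 1 - digit p j u\<close>. The scaffold condition
  that this digit be at least 1 says exactly that adding \<open>p ^ j\<close> to \<open>u\<close>
  causes no carry.\<close>

lemma shifts_Psi:
  assumes j: "j < n"
  shows "shifts (Psi (n - j)) (p ^ j)"
  unfolding shifts_def
proof (intro allI impI)
  fix u assume u: "u < q"
  let ?i = "n - j" and ?t = "bp + B u"
  have i: "?i \<in> {1..n}" and ni: "n - ?i = j" using j by auto
  have Bp: "int p ^ j * bs ?i = B (p ^ j)" using bfrak_power[OF p_gt_1 j] by simp
  have nc1: "nc (q - 1 - u) u" and dig: "digit p j (q - 1 - u) = p - 1 - digit p j u"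
    using digit_complement[OF p_pos _ j] u by (auto simp: q_def)
  have "B (q - 1 - u) + ?t = B (q - 1) + bp"
    using B_add[OF nc1] u by simp
  then have "(B (q - 1 - u) + ?t) mod Q = 0" using bp_mod by (simp only:)
  then have af: "afrak p n bs ?t = q - 1 - u"
    using u by (intro afrak_eqI[OF prime cop]) (simp_all add: q_def Q_def)
  have "nc (p ^ j) u \<longleftrightarrow> (\<forall>k<n. (if k = j then 1 else 0) + digit p k u < p)"
    using p_gt_1 by (simp add: nocarry_def digit_power)
  also have "\<dots> \<longleftrightarrow> 1 \<le> digit p j (afrak p n bs ?t)"
    unfolding af dig using j digit_less[OF p_pos, of _ u] by auto
  finally have nc: "nc (p ^ j) u \<longleftrightarrow> 1 \<le> digit p j (afrak p n bs ?t)" .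
  obtain c where c: "c \<in> K" "c \<noteq> 0" "vL c = 0"
    "if 1 \<le> digit p j (afrak p n bs ?t)
     then tol_zero vL T (?t + B (p ^ j)) (act (Psi ?i) (lam ?t) - c * lam (?t + B (p ^ j)))
     else tol_zero vL T (?t + B (p ^ j)) (act (Psi ?i) (lam ?t))"
    using Psi_lam[OF i, of ?t] unfolding ni Bp by blast
  have pj: "p ^ j < q" unfolding q_def using p_gt_1 j by simp
  have "act (Psi ?i) (f u) - (if nc (p ^ j) u then c * f (u + p ^ j) else 0)
      \<in> vpow vL (?t + B (p ^ j) + (Q + bp - h))"
  proof (cases "nc (p ^ j) u")
    case True
    then have "B (u + p ^ j) = B u + B (p ^ j)"
      using pj u by (intro B_add')
    then have fu: "f (u + p ^ j) = lam (?t + B (p ^ j))" by (simp add: f_def add.assoc)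
    have "tol_zero vL T (?t + B (p ^ j)) (act (Psi ?i) (lam ?t) - c * lam (?t + B (p ^ j)))"
      using c(4) True nc by simp
    from tol_zero_vpow[OF this] show ?thesis using True unfolding fu f_def[of u] by simp
  next
    case False
    then have "tol_zero vL T (?t + B (p ^ j)) (act (Psi ?i) (lam ?t))"
      using c(4) nc by simp
    from tol_zero_vpow[OF this] show ?thesis using False unfolding f_def[of u] by simp
  qed
  then show "\<exists>c\<in>K. c \<noteq> 0 \<and> vL c = 0 \<and> act (Psi ?i) (f u)
      - (if nc (p ^ j) u then c * f (u + p ^ j) else 0) \<in> vpow vL (?t + B (p ^ j) + (Q + bp - h))"
    using c by blast
qed

text \<open>The normalization at \<open>1\<close> makes the coefficient of \<open>\<Phi>\<^sub>0\<close> equal to evaluation at \<open>1\<close>. This puts products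
  of two elements of \<open>M\<close> into \<open>P\<^sub>K\<^sup>2\<close> at that coefficient, so that \<open>\<pi> \<notin> M\<^sup>2\<close>.\<close>
lemma shift_operator_ex:
  "s < q \<Longrightarrow> \<exists>\<alpha>. shifts \<alpha> s \<and> (if s = 0 then \<alpha> = 1 else act \<alpha> 1 = 0)"
proof (induction s rule: less_induct)
  case (less s)
  show ?case
  proof (cases "s = 0")
    case True
    then show ?thesis using shifts_1 by auto
  next
    case False
    have "\<exists>j<n. digit p j s \<noteq> 0"
    proof (rule ccontr)
      assume "\<not> (\<exists>j<n. digit p j s \<noteq> 0)"
      then have "s = 0" using digit_eqI[of s p n 0] less.prems p_pos by (simp add: q_def)
      then show False using False by simp
    qed
    then obtain j where j: "j < n" "digit p j s \<noteq> 0" by blast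
    have pj: "p ^ j < q" unfolding q_def using p_gt_1 j by simp
    have "preceq p n (p ^ j) s" using j p_gt_1 by (auto simp: preceq_def digit_power)
    then have le: "p ^ j \<le> s" and nc: "nc (p ^ j) (s - p ^ j)"
      using preceq_diff[of p n "p ^ j" s] pj less.prems p_pos by (simp_all add: q_def)
    let ?s = "s - p ^ j"
    have s: "?s < s" "?s < q" "?s + p ^ j = s" using le False less.prems p_pos by auto
    obtain \<alpha> where \<alpha>: "shifts \<alpha> ?s" using less.IH[OF s(1,2)] by blast
    \<comment> \<open>The new factor stands on the right, where it meets 1 first and annihilates
      it.\<close>
    have "shifts (\<alpha> * Psi (n - j)) s"
      using shifts_mult[OF \<alpha> shifts_Psi[OF j(1)]] nc s pj by (simp add: nocarry_commute)
    moreover have "act (Psi (n - j)) 1 = 0"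
    proof -
      have "n - j \<in> {1..n}" using j(1) by auto
      then show ?thesis by (rule Psi_act_1)
    qed
    ultimately show ?thesis using False by (intro exI[of _ "\<alpha> * Psi (n - j)"]) (simp add: act_mult)
  qed
qed

definition Psis :: "nat \<Rightarrow> 'A" where
  "Psis s = (SOME \<alpha>. shifts \<alpha> s \<and> (if s = 0 then \<alpha> = 1 else act \<alpha> 1 = 0))"

lemma shifts_Psis: "s < q \<Longrightarrow> shifts (Psis s) s"
  and Psis_0: "Psis 0 = 1"
  and Psis_act_1: "s < q \<Longrightarrow> s \<noteq> 0 \<Longrightarrow> act (Psis s) 1 = 0"
  using someI_ex[OF shift_operator_ex, of s] someI_ex[OF shift_operator_ex[OF q_pos]]
  by (auto simp: Psis_def)

section \<open>The floors \<open>d\<close> and the minimal increments \<open>w\<close>\<close>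

lemma d_eq: "d u = (B u + bp - h) div Q"
  by (simp add: dfun_def Q_def bp_def)

text \<open>Division with remainder by \<open>Q\<close>. It puts the valuations of all rescaled
  basis elements into the same window of length \<open>Q\<close>.\<close>

lemma d_bounds: "h \<le> bp + B u - Q * d u" "bp + B u - Q * d u < h + Q"
proof -
  have "Q * d u + (B u + bp - h) mod Q = B u + bp - h"
    by (simp add: d_eq)
  moreover have "0 \<le> (B u + bp - h) mod Q" "(B u + bp - h) mod Q < Q"
    using Q_pos by simp_all
  ultimately show "h \<le> bp + B u - Q * d u" "bp + B u - Q * d u < h + Q" by linarith+
qed

lemma d_0: "d 0 = 0"
  using bp_bounds by (simp add: d_eq)

text \<open>Replacing \<open>u\<close> by \<open>u + s\<close> exhibits \<open>w s\<close> as the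
  least increase of \<open>d\<close> under a carry-free shift by \<open>s\<close>.\<close>

lemma w_eq: "w s = Min {d (u + s) - d u | u. u < q \<and> nc s u}" if "s < q"
proof -
  have "{d u - d (u - s) | u. u < q \<and> preceq p n s u} = {d (u + s) - d u | u. u < q \<and> nc s u}"
    (is "?X = ?Y")
  proof (intro equalityI subsetI)
    fix x assume "x \<in> ?X"
    then obtain u where u: "x = d u - d (u - s)" "u < q" "preceq p n s u" by blast
    then have "s \<le> u" "nc s (u - s)"
      using preceq_diff[OF u(3)] that p_pos by (simp_all add: q_def)
    then show "x \<in> ?Y" using u by (intro CollectI exI[of _ "u - s"]) auto
  next
    fix x assume "x \<in> ?Y"
    then obtain u where u: "x = d (u + s) - d u" "u < q" "nc s u" by blast
    then have "preceq p n s (u + s)" "u + s < q"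
      using nocarry_preceq[OF u(3)] nc_less[OF u(3)] that by (simp_all add: q_def add.commute)
    then show "x \<in> ?X" using u by (intro CollectI exI[of _ "u + s"]) auto
  qed
  then show ?thesis by (simp add: wfun_def q_def)
qed

lemma w_le: "nc s u \<Longrightarrow> s < q \<Longrightarrow> u < q \<Longrightarrow> w s \<le> d (u + s) - d u"
  unfolding w_eq by (rule Min_le) auto

lemma w_attained: "s < q \<Longrightarrow> \<exists>u<q. nc s u \<and> w s = d (u + s) - d u"
proof -
  assume s: "s < q"
  let ?Y = "{d (u + s) - d u | u. u < q \<and> nc s u}"
  have "d (0 + s) - d 0 \<in> ?Y" using q_pos p_pos by (intro CollectI exI[of _ 0]) simp
  then have "Min ?Y \<in> ?Y" by (intro Min_in) auto
  then show ?thesis unfolding w_eq[OF s] by blast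
qed

lemma w_0: "w 0 = 0"
  using w_attained[OF q_pos] by auto

lemma w_le_d: "s < q \<Longrightarrow> w s \<le> d s"
  using w_le[of s 0] q_pos p_pos by (simp add: d_0)

section \<open>The rescaled bases \<open>e\<close> and \<open>Phi\<close>\<close>

definition e :: "nat \<Rightarrow> 'L" where "e u = pw (- d u) * f u"
definition Phi :: "nat \<Rightarrow> 'A" where "Phi s = \<iota> (pw (- w s)) * Psis s"

text \<open>The pairs at which the minimum \<open>w s\<close> is attained; at exactly these,
  \<open>Phi s\<close> does not kill \<open>e u\<close> modulo the maximal ideal.\<close>

definition tight :: "nat \<Rightarrow> nat \<Rightarrow> bool" where
  "tight s u \<longleftrightarrow> nc s u \<and> w s = d (u + s) - d u"

lemma e_nonzero: "e u \<noteq> 0" and v_e: "vL (e u) = bp + B u - Q * d u"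
  by (simp_all add: e_def f_nonzero pw_nonzero v_mult v_f v_pw)

lemma e_basis: "L.kbasis q e"
  by (rule graded_kbasis) (simp add: e_nonzero v_e)

lemma Phi_0: "Phi 0 = 1"
  by (simp add: Phi_def Psis_0 w_0 pw_0)

lemma Phi_act_1: "s < q \<Longrightarrow> s \<noteq> 0 \<Longrightarrow> act (Phi s) 1 = 0"
  by (simp add: Phi_def act_scal_left pw_K Psis_act_1)

text \<open>Applied to \<open>f 0\<close>, the operators give elements with valuations congruent to
  \<open>bp + B s\<close> modulo \<open>Q\<close>, which are independent. So the operators are
  independent too, and their number is the dimension of \<open>A\<close>.\<close>

lemma Phi_basis: "A.kbasis q Phi"
proof -
  define g where "g s = act (Phi s) (f 0)" for s
  have g: "g s \<noteq> 0 \<and> Q dvd vL (g s) - (bp + B s)" if s: "s < q" for s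
  proof -
    obtain c where c: "c \<in> K" "c \<noteq> 0" "vL c = 0"
      "act (Psis s) (f 0) - (if nc s 0 then c * f (0 + s) else 0)
        \<in> vpow vL (bp + B 0 + B s + (Q + bp - h))"
      using shifts_Psis[OF s] q_pos unfolding shifts_def by blast
    have cf: "c * f s \<noteq> 0" "vL (c * f s) = bp + B s" using c by (simp_all add: f_nonzero v_mult v_f)
    have "act (Psis s) (f 0) - c * f s \<in> vpow vL (vL (c * f s) + 1)"
      using c(4) p_pos bp_bounds Q_pos unfolding cf(2) by (auto elim: vpow_mono)
    from v_eq_of_close[OF cf(1) this] cf(2) show ?thesis
      by (simp add: g_def Phi_def act_scal_left pw_K pw_nonzero v_mult v_pw)
  qed
  have "A.kindep q Phi"
    unfolding A.kindep_def
  proof (intro allI impI)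
    fix c s assume c: "\<forall>s<q. c s \<in> K" "(\<Sum>s<q. \<iota> (c s) * Phi s) = 0" and s: "s < q"
    have "(\<Sum>s<q. c s * g s) = act (\<Sum>s<q. \<iota> (c s) * Phi s) (f 0)"
      using c(1) by (simp add: act_sum_left act_scal_left g_def)
    also have "\<dots> = 0" using c(2) by simp
    finally have "(\<Sum>s<q. c s * g s) = 0" .
    then show "c s = 0" using L.kindepD[OF graded_kindep[OF g], of c s] c(1) s by simp
  qed
  then show ?thesis using A.kindep_kbasis[OF dim_A] by (simp add: q_def)
qed

text \<open>For a carry-free pair the scalar in front of \<open>e (u + s)\<close> has valuation
  \<open>Q * (d (u + s) - d u - w s)\<close>: a unit if the pair is tight, and otherwise so small
  that the main term joins the error.\<close>

lemma Phi_e_ex: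
  assumes s: "s < q" and u: "u < q"
  shows "\<exists>c. c \<in> OK K vL \<and> (tight s u \<longrightarrow> c \<notin> PK K vL) \<and> (\<not> tight s u \<longrightarrow> c = 0) \<and>
    act (Phi s) (e u) - c * e (u + s) \<in> vpow vL (h + Q)"
proof -
  obtain c where c: "c \<in> K" "c \<noteq> 0" "vL c = 0"
    "act (Psis s) (f u) - (if nc s u then c * f (u + s) else 0) \<in> vpow vL (bp + B u + B s + (Q + bp - h))"
    using shifts_Psis[OF s] u unfolding shifts_def by blast
  define r where "r = pw (- w s) * pw (- d u)"
  have r: "r \<in> K" "r \<noteq> 0" "vL r = - Q * (w s + d u)"
    by (simp_all add: r_def K_mult pw_K pw_nonzero v_mult v_pw algebra_simps)
  \<comment> \<open>The tolerance enters here: with \<open>w s \<le> d s\<close>, the lower bounds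
    of \<open>d_bounds\<close> at \<open>s\<close> and at \<open>u\<close> add up to exactly what
    the error needs to reach \<open>h + Q\<close>.\<close>
  have "Q * w s \<le> Q * d s" using w_le_d[OF s] Q_pos by simp
  then have "h + Q \<le> bp + B u + B s + (Q + bp - h) + vL r"
    using d_bounds[of s] d_bounds[of u] r(3)[unfolded distrib_left minus_mult_left[symmetric]]
    by linarith
  then have "r * (act (Psis s) (f u) - (if nc s u then c * f (u + s) else 0)) \<in> vpow vL (h + Q)"
    unfolding vpow_mult_iff[OF r(2)] by (intro vpow_mono[OF c(4)]) linarith
  moreover have "r * act (Psis s) (f u) = act (Phi s) (e u)"
    by (simp add: r_def Phi_def e_def act_scal_left act_scal_right pw_K)
  ultimately have err: "act (Phi s) (e u) - r * (if nc s u then c * f (u + s) else 0) \<in> vpow vL (h + Q)"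
    by (simp add: right_diff_distrib)
  show ?thesis
  proof (cases "nc s u")
    case False
    then show ?thesis using err by (intro exI[of _ 0]) (simp add: tight_def)
  next
    case True
    define c' where "c' = r * c / pw (- d (u + s))"
    have c': "c' \<in> K" "c' \<noteq> 0" "vL c' = Q * (d (u + s) - d u - w s)"
      using r c by (simp_all add: c'_def K_mult K_divide pw_K pw_nonzero v_divide v_mult v_pw algebra_simps)
    have "c' * e (u + s) = r * (c * f (u + s))"
      by (simp add: c'_def e_def pw_nonzero)
    with err True have err': "act (Phi s) (e u) - c' * e (u + s) \<in> vpow vL (h + Q)" by simp
    show ?thesis
    proof (cases "tight s u")
      case True
      then have "vL c' = 0" using c' by (simp add: tight_def)
      then have "c' \<in> OK K vL" "c' \<notin> PK K vL" using c'(1,2) by (simp_all add: OK_def PK_def)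
      then show ?thesis using err' True by blast
    next
      case False
      then have "1 \<le> d (u + s) - d u - w s" using w_le[OF True s u] True by (simp add: tight_def)
      then have "Q * 1 \<le> vL c'" unfolding c'(3) using Q_pos by (intro mult_left_mono) auto
      then have "c' * e (u + s) \<in> vpow vL (h + Q)"
        using c'(2) d_bounds[of "u + s"] by (simp add: vpow_def v_mult e_nonzero v_e)
      from vpow_add[OF err' this] False show ?thesis
        by (intro exI[of _ 0]) simp
    qed
  qed
qed

text \<open>The constant is exactly 0 off the tight pairs, so tightness can be inferred from its
  being nonzero.\<close>

definition eps :: "nat \<Rightarrow> nat \<Rightarrow> 'L" where
  "eps s u = (SOME c. c \<in> OK K vL \<and> (tight s u \<longrightarrow> c \<notin> PK K vL) \<and> (\<not> tight s u \<longrightarrow> c = 0) \<and>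
    act (Phi s) (e u) - c * e (u + s) \<in> vpow vL (h + Q))"

lemma eps:
  assumes "s < q" "u < q"
  shows eps_OK: "eps s u \<in> OK K vL" and eps_unit: "tight s u \<Longrightarrow> eps s u \<notin> PK K vL"
    and eps_0: "\<not> tight s u \<Longrightarrow> eps s u = 0"
    and Phi_e: "act (Phi s) (e u) - eps s u * e (u + s) \<in> vpow vL (h + Q)"
proof -
  have "eps s u \<in> OK K vL \<and> (tight s u \<longrightarrow> eps s u \<notin> PK K vL) \<and> (\<not> tight s u \<longrightarrow> eps s u = 0) \<and>
      act (Phi s) (e u) - eps s u * e (u + s) \<in> vpow vL (h + Q)"
    unfolding eps_def by (rule someI_ex[OF Phi_e_ex[OF assms]])
  then show "eps s u \<in> OK K vL" "tight s u \<Longrightarrow> eps s u \<notin> PK K vL" "\<not> tight s u \<Longrightarrow> eps s u = 0"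
    "act (Phi s) (e u) - eps s u * e (u + s) \<in> vpow vL (h + Q)" by blast+
qed

abbreviation "cL \<equiv> L.coord q e"
abbreviation "cA \<equiv> A.coord q Phi"

text \<open>The terms can be tested one by one. The valuation of \<open>e u\<close> lies in the
  window from \<open>h\<close> to \<open>h + Q - 1\<close> and that of its coefficient is a multiple
  of \<open>Q\<close>, so the sign of the latter decides.\<close>

lemma vpow_h_iff: "x \<in> vpow vL h \<longleftrightarrow> (\<forall>u<q. cL x u \<in> OK K vL)" (is ?A)
  and vpow_h_Q_iff: "x \<in> vpow vL (h + Q) \<longleftrightarrow> (\<forall>u<q. cL x u \<in> PK K vL)" (is ?B)
proof -
  have cK: "cL x u \<in> K" if "u < q" for u by (rule L.coord_in_K[OF e_basis that])
  have x: "(\<Sum>u<q. cL x u * e u) = x" by (rule L.coord_sum[OF e_basis])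
  have iff: "x \<in> vpow vL m \<longleftrightarrow> (\<forall>u<q. cL x u * e u \<in> vpow vL m)" for m
  proof
    assume "x \<in> vpow vL m"
    then show "\<forall>u<q. cL x u * e u \<in> vpow vL m"
      using cK x by (intro allI impI graded_sum_vpow[where g = e]) (auto simp: e_nonzero v_e)
  next
    assume "\<forall>u<q. cL x u * e u \<in> vpow vL m"
    then have "(\<Sum>u<q. cL x u * e u) \<in> vpow vL m" by (intro vpow_sum) auto
    then show "x \<in> vpow vL m" unfolding x .
  qed
  have *: "(cL x u * e u \<in> vpow vL h \<longleftrightarrow> cL x u \<in> OK K vL) \<and>
      (cL x u * e u \<in> vpow vL (h + Q) \<longleftrightarrow> cL x u \<in> PK K vL)" if u: "u < q" for u
  proof (cases "cL x u = 0")
    case False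
    obtain k where k: "vL (cL x u) = Q * k" using K_val[OF cK[OF u] False] by blast
    have "h \<le> Q * k + vL (e u) \<longleftrightarrow> 0 \<le> Q * k"
    proof
      assume "h \<le> Q * k + vL (e u)"
      then have "0 < Q * (k + 1)" using d_bounds[of u] by (simp add: v_e algebra_simps)
      then have "0 \<le> k" using Q_pos by (simp add: zero_less_mult_iff)
      then show "0 \<le> Q * k" using Q_pos by simp
    qed (use d_bounds[of u] in \<open>simp add: v_e\<close>)
    moreover have "h + Q \<le> Q * k + vL (e u) \<longleftrightarrow> 0 < Q * k"
    proof
      assume "0 < Q * k"
      then have "1 \<le> k" using Q_pos by (simp add: zero_less_mult_iff)
      then have "Q * 1 \<le> Q * k" using Q_pos by (intro mult_left_mono) auto
      then show "h + Q \<le> Q * k + vL (e u)" unfolding v_e using d_bounds[of u] by linarith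
    qed (use d_bounds[of u] in \<open>simp add: v_e\<close>)
    ultimately show ?thesis using False cK[OF u]
      by (simp add: vpow_def OK_def PK_def v_mult e_nonzero k)
  qed simp
  show ?A ?B unfolding iff[of h] iff[of "h + Q"] using * by auto
qed

end

section \<open>The associated order and its action modulo the maximal ideal\<close>

context valued_kmod
begin

definition submod :: "'v set \<Rightarrow> bool" where
  "submod Y \<longleftrightarrow> 0 \<in> Y \<and> (\<forall>x\<in>Y. \<forall>y\<in>Y. x + y \<in> Y) \<and> (\<forall>c\<in>OK K v. \<forall>x\<in>Y. scal c x \<in> Y)"

text \<open>This is \<open>Y\<close> plus the maximal ideal times the lattice spanned by
  \<open>g\<close>; it replaces the reduction of \<open>Y\<close> modulo that ideal.\<close>

definition near :: "nat \<Rightarrow> (nat \<Rightarrow> 'v) \<Rightarrow> 'v set \<Rightarrow> 'v set" where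
  "near N g Y = {x. \<exists>y\<in>Y. \<forall>j<N. coord N g (x - y) j \<in> PK K v}"

lemma submod_0: "submod Y \<Longrightarrow> 0 \<in> Y"
  and submod_add: "submod Y \<Longrightarrow> x \<in> Y \<Longrightarrow> y \<in> Y \<Longrightarrow> x + y \<in> Y"
  and submod_scal: "submod Y \<Longrightarrow> c \<in> OK K v \<Longrightarrow> x \<in> Y \<Longrightarrow> scal c x \<in> Y"
  by (simp_all add: submod_def)

lemma submod_sum: "submod Y \<Longrightarrow> (\<And>i. i \<in> I \<Longrightarrow> x i \<in> Y) \<Longrightarrow> (\<Sum>i\<in>I. x i) \<in> Y"
  by (induction I rule: infinite_finite_induct) (auto simp: submod_0 submod_add)

context
  fixes N g Y assumes basis: "kbasis N g" and Y: "submod Y"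
begin

lemma near_coord: "(\<And>j. j < N \<Longrightarrow> coord N g x j \<in> PK K v) \<Longrightarrow> x \<in> near N g Y"
  using submod_0[OF Y] by (auto simp: near_def intro!: bexI[of _ 0])

lemma subset_near: "Y \<subseteq> near N g Y"
proof
  fix x assume "x \<in> Y"
  then show "x \<in> near N g Y"
    unfolding near_def by (intro CollectI bexI[of _ x]) (auto simp: coord_0[OF basis])
qed

lemma near_submod: "submod (near N g Y)"
  unfolding submod_def
proof (intro conjI ballI)
  show "0 \<in> near N g Y" using subset_near submod_0[OF Y] by blast
  show "x + x' \<in> near N g Y" if x: "x \<in> near N g Y" and x': "x' \<in> near N g Y" for x x'
  proof -
    obtain y where y: "y \<in> Y" "\<And>j. j < N \<Longrightarrow> coord N g (x - y) j \<in> PK K v"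
      using x by (auto simp: near_def)
    obtain y' where y': "y' \<in> Y" "\<And>j. j < N \<Longrightarrow> coord N g (x' - y') j \<in> PK K v"
      using x' by (auto simp: near_def)
    have "coord N g ((x + x') - (y + y')) j \<in> PK K v" if "j < N" for j
    proof -
      have "(x + x') - (y + y') = (x - y) + (x' - y')" by simp
      then show ?thesis using y y' that by (simp only: coord_add[OF basis] PK_add)
    qed
    then show ?thesis using submod_add[OF Y y(1) y'(1)] by (auto simp: near_def)
  qed
  show "scal c x \<in> near N g Y" if c: "c \<in> OK K v" and x: "x \<in> near N g Y" for c x
  proof -
    obtain y where y: "y \<in> Y" "\<And>j. j < N \<Longrightarrow> coord N g (x - y) j \<in> PK K v"
      using x by (auto simp: near_def)
    have eq: "scal c x - scal c y = scal c (x - y)"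
      using scal_add_right[OF OK_K[OF c], of "x - y" y] by simp
    have "coord N g (scal c x - scal c y) j \<in> PK K v" if "j < N" for j
      unfolding eq using c y that by (simp add: coord_scal[OF basis] OK_K PK_mult_left)
    then show ?thesis using submod_scal[OF Y c y(1)] by (auto simp: near_def)
  qed
qed

lemma near_unit_scal:
  assumes "c \<in> OK K v" "c \<notin> PK K v" "scal c x \<in> near N g Y"
  shows "x \<in> near N g Y"
proof -
  have "scal (inverse c) (scal c x) \<in> near N g Y"
    using near_submod unit_inverse assms by (blast intro: submod_scal)
  moreover have "c \<noteq> 0" "c \<in> K" using assms unit_nonzero OK_K by auto
  ultimately show ?thesis by (simp add: scal_scal K_inverse)
qed

lemma nakayama_near:
  assumes "\<And>i. i < N \<Longrightarrow> g i \<in> near N g Y" "\<And>i. i < N \<Longrightarrow> coord N g x i \<in> OK K v"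
  shows "x \<in> Y"
proof -
  have "g i \<in> Y" if "i < N" for i
  proof (rule nakayama[OF _ _ _ _ that])
    show "0 \<in> Y" using Y by (rule submod_0)
    show "x + y \<in> Y" if "x \<in> Y" "y \<in> Y" for x y using Y that by (rule submod_add)
    show "scal c x \<in> Y" if "c \<in> OK K v" "x \<in> Y" for c x using Y that by (rule submod_scal)
    fix i assume "i < N"
    from assms(1)[OF this] obtain y where y: "y \<in> Y" "\<And>j. j < N \<Longrightarrow> coord N g (g i - y) j \<in> PK K v"
      by (auto simp: near_def)
    have "g i = y + (\<Sum>j<N. scal (coord N g (g i - y) j) (g j))"
      unfolding coord_sum[OF basis] by simp
    then show "\<exists>y\<in>Y. \<exists>c. (\<forall>j<N. c j \<in> PK K v) \<and> g i = y + (\<Sum>j<N. scal (c j) (g j))"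
      using y by (intro bexI[of _ y] exI[of _ "coord N g (g i - y)"]) auto
  qed
  then have "(\<Sum>i<N. scal (coord N g x i) (g i)) \<in> Y"
    using assms(2) by (intro submod_sum[OF Y] submod_scal[OF Y]) auto
  then show ?thesis unfolding coord_sum[OF basis] .
qed

end

end

context scaffold_setting
begin

abbreviation "Ok \<equiv> OK K vL"
abbreviation "Pk \<equiv> PK K vL"
abbreviation "R \<equiv> assoc_order act vL h"

lemma OK_vpow: "c \<in> Ok \<Longrightarrow> x \<in> vpow vL m \<Longrightarrow> c * x \<in> vpow vL m"
  using vpow_mult[of c 0 x m] by (simp add: OK_eq)

lemma R_vpow: "\<alpha> \<in> R \<Longrightarrow> x \<in> vpow vL h \<Longrightarrow> act \<alpha> x \<in> vpow vL h"
  by (simp add: assoc_order_def)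

lemma R_I: "(\<And>x. x \<in> vpow vL h \<Longrightarrow> act \<alpha> x \<in> vpow vL h) \<Longrightarrow> \<alpha> \<in> R"
  by (simp add: assoc_order_def)

lemma R_vpow_Q:
  assumes "\<alpha> \<in> R" "x \<in> vpow vL (h + Q)"
  shows "act \<alpha> x \<in> vpow vL (h + Q)"
proof -
  let ?y = "inverse (pw 1) * x"
  have "?y \<in> vpow vL h"
    using assms(2) vpow_mult_iff[of "inverse (pw 1)" x h] by (simp add: pw_nonzero v_inverse v_pw)
  from R_vpow[OF assms(1) this] have "pw 1 * act \<alpha> ?y \<in> vpow vL (h + Q)"
    using vpow_mult_iff[of "pw 1"] by (simp add: pw_nonzero v_pw)
  moreover have "pw 1 * act \<alpha> ?y = act \<alpha> (pw 1 * ?y)" by (simp only: act_scal_right pw_K)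
  moreover have "pw 1 * ?y = x" by (simp add: pw_nonzero)
  ultimately show ?thesis by simp
qed

lemma R_0: "0 \<in> R" and R_1: "1 \<in> R"
  and R_add: "\<alpha> \<in> R \<Longrightarrow> \<beta> \<in> R \<Longrightarrow> \<alpha> + \<beta> \<in> R"
  and R_mult: "\<alpha> \<in> R \<Longrightarrow> \<beta> \<in> R \<Longrightarrow> \<alpha> * \<beta> \<in> R"
  and R_scal: "c \<in> Ok \<Longrightarrow> \<alpha> \<in> R \<Longrightarrow> \<iota> c * \<alpha> \<in> R"
  and R_iota: "c \<in> Ok \<Longrightarrow> \<iota> c \<in> R"
  by (rule R_I, simp add: act_add_left act_mult act_scal_left act_iota vpow_add R_vpow OK_K OK_vpow)+

lemma iota_uminus: "c \<in> K \<Longrightarrow> \<iota> (- c) * \<alpha> = - (\<iota> c * \<alpha>)"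
  by (rule A.scal_uminus_left)

lemma OK_m1: "- 1 \<in> Ok"
  by (simp add: OK_uminus)

lemma uminus_eq: "- \<alpha> = \<iota> (- 1) * \<alpha>"
  using iota_uminus[of 1 \<alpha>] by simp

lemma R_uminus: "\<alpha> \<in> R \<Longrightarrow> - \<alpha> \<in> R"
  unfolding uminus_eq[of \<alpha>] by (rule R_scal[OF OK_m1])

lemma R_diff: "\<alpha> \<in> R \<Longrightarrow> \<beta> \<in> R \<Longrightarrow> \<alpha> - \<beta> \<in> R"
  using R_add[of \<alpha> "- \<beta>"] R_uminus by simp

lemma cA_K: "s < q \<Longrightarrow> cA \<alpha> s \<in> K"
  by (rule A.coord_in_K[OF Phi_basis])

lemma cA_sum: "(\<Sum>s<q. \<iota> (cA \<alpha> s) * Phi s) = \<alpha>"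
  by (rule A.coord_sum[OF Phi_basis])

lemma act_eq_sum: "act \<alpha> x = (\<Sum>s<q. cA \<alpha> s * act (Phi s) x)"
  by (subst cA_sum[of \<alpha>, symmetric]) (simp add: act_sum_left act_scal_left cA_K)

text \<open>Every \<open>Phi s\<close> with \<open>s \<noteq> 0\<close> kills 1, so only
  \<open>Phi 0 = 1\<close> contributes. Modulo \<open>Pk\<close> this coefficient is the residue map
  of \<open>R\<close>.\<close>

lemma cA_0: "cA \<alpha> 0 = act \<alpha> 1"
proof -
  have "act \<alpha> 1 = (\<Sum>s\<in>{0}. cA \<alpha> s * act (Phi s) 1)"
    unfolding act_eq_sum[of \<alpha> 1] using q_pos
    by (intro sum.mono_neutral_right) (auto simp: Phi_act_1)
  then show ?thesis by (simp add: Phi_0)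
qed

text \<open>\<open>e (u + s)\<close> is defined even when it is no basis element; an index out of
  range means a carry, so its constant is 0.\<close>

lemma eps_overflow:
  assumes "s < q" "u < q" "\<not> u + s < q"
  shows "eps s u = 0"
proof (rule eps_0[OF assms(1,2)])
  show "\<not> tight s u"
    using nc_less[OF _ assms(1,2)] assms(3) by (auto simp: tight_def add.commute[of u s])
qed

lemma Phi_coord:
  assumes "s < q" "u < q" "v < q"
  shows "cL (act (Phi s) (e u)) v - (if v = u + s then eps s u else 0) \<in> Pk"
proof -
  have "cL (act (Phi s) (e u) - eps s u * e (u + s)) v \<in> Pk"
    using Phi_e[OF assms(1,2)] assms(3) vpow_h_Q_iff by blast
  moreover have "cL (eps s u * e (u + s)) v = (if v = u + s then eps s u else 0)"
  proof (cases "u + s < q")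
    case True
    then show ?thesis
      using assms L.coord_scal[OF e_basis OK_K[OF eps_OK[OF assms(1,2)]] assms(3)]
        L.coord_basis[OF e_basis True assms(3)] by simp
  next
    case False
    then have "eps s u = 0" using assms by (intro eps_overflow)
    then show ?thesis using assms by (simp add: L.coord_0[OF e_basis])
  qed
  ultimately show ?thesis by (simp add: L.coord_diff[OF e_basis assms(3)])
qed

text \<open>\<open>Phi 0\<close> is the identity, but \<open>eps\<close> is a choice that is only
  determined modulo \<open>Pk\<close>.\<close>

lemma eps_zero_left: "u < q \<Longrightarrow> eps 0 u - 1 \<in> Pk"
  using Phi_coord[of 0 u u] q_pos L.coord_basis[OF e_basis, of u u] PK_uminus[of "1 - eps 0 u"]
  by (simp add: Phi_0)

text \<open>Modulo \<open>Pk\<close> only the summand with \<open>Phi (v - u)\<close> leads from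
  \<open>e u\<close> to \<open>e v\<close>, so the matrix of \<open>\<alpha>\<close> is triangular;
  by \<open>eps_zero_left\<close> its diagonal is constant.\<close>

lemma act_coord:
  assumes \<alpha>: "\<And>s. s < q \<Longrightarrow> cA \<alpha> s \<in> Ok" and u: "u < q" and v: "v < q"
  shows "cL (act \<alpha> (e u)) v - (if u \<le> v then cA \<alpha> (v - u) * eps (v - u) u else 0) \<in> Pk"
proof -
  have eq: "cL (act \<alpha> (e u)) v = (\<Sum>s<q. cA \<alpha> s * cL (act (Phi s) (e u)) v)"
    unfolding act_eq_sum[of \<alpha> "e u"]
    by (simp add: L.coord_sum_fun[OF e_basis v] L.coord_scal[OF e_basis _ v] cA_K)
  have trm: "cA \<alpha> s * cL (act (Phi s) (e u)) v - cA \<alpha> s * (if v = u + s then eps s u else 0) \<in> Pk"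
    if "s < q" for s
    using PK_mult_left[OF \<alpha>[OF that] Phi_coord[OF that u v]] by (simp add: right_diff_distrib)
  show ?thesis
  proof (cases "u \<le> v")
    case True
    have "(\<Sum>s<q. cA \<alpha> s * cL (act (Phi s) (e u)) v) - cA \<alpha> (v - u) * eps (v - u) u \<in> Pk"
    proof (rule sum_single_cong[where k = "v - u"])
      fix s assume s: "s \<in> {..<q}" "s \<noteq> v - u"
      then have "v \<noteq> u + s" by auto
      then show "cA \<alpha> s * cL (act (Phi s) (e u)) v \<in> Pk" using trm[of s] s(1) by simp
    next
      show "cA \<alpha> (v - u) * cL (act (Phi (v - u)) (e u)) v - cA \<alpha> (v - u) * eps (v - u) u \<in> Pk"
        using trm[of "v - u"] True v by simp
    qed (use v in auto)
    then show ?thesis using True by (simp add: eq)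
  next
    case False
    have "(\<Sum>s<q. cA \<alpha> s * cL (act (Phi s) (e u)) v) \<in> Pk"
    proof (rule PK_sum)
      fix s assume s: "s \<in> {..<q}"
      have "v \<noteq> u + s" using False by auto
      then show "cA \<alpha> s * cL (act (Phi s) (e u)) v \<in> Pk" using trm[of s] s by simp
    qed
    then show ?thesis using False by (simp add: eq)
  qed
qed

lemma tight_ex: "s < q \<Longrightarrow> \<exists>u<q. tight s u \<and> u + s < q"
  using w_attained[of s] nc_less[of s] by (auto simp: tight_def add.commute)

lemma unit_cancel: "a * b \<in> Pk \<Longrightarrow> a \<in> Ok \<Longrightarrow> b \<in> Ok \<Longrightarrow> b \<notin> Pk \<Longrightarrow> a \<in> Pk"
  using unit_mult by blast

text \<open>A \<open>u\<close> tight for \<open>s\<close> isolates one coefficient: the entry from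
  \<open>e u\<close> to \<open>e (u + s)\<close> is \<open>cA \<alpha> s\<close> times a
  unit.\<close>

lemma faithful:
  assumes \<alpha>: "\<And>s. s < q \<Longrightarrow> cA \<alpha> s \<in> Ok"
    and zero: "\<And>u. u < q \<Longrightarrow> act \<alpha> (e u) \<in> vpow vL (h + Q)" and s: "s < q"
  shows "cA \<alpha> s \<in> Pk"
proof -
  obtain u where u: "u < q" "tight s u" "u + s < q" using tight_ex[OF s] by blast
  have "cL (act \<alpha> (e u)) (u + s) - cA \<alpha> s * eps s u \<in> Pk"
    using act_coord[OF \<alpha> u(1) u(3)] by simp
  moreover have "cL (act \<alpha> (e u)) (u + s) \<in> Pk" using zero[OF u(1)] u(3) vpow_h_Q_iff by blast
  ultimately have "cA \<alpha> s * eps s u \<in> Pk" using PK_cong by blast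
  then show ?thesis using unit_cancel \<alpha>[OF s] eps_OK[OF s u(1)] eps_unit[OF s u(1) u(2)] by blast
qed

lemma e_vpow: "e u \<in> vpow vL h"
  using d_bounds(1)[of u] by (simp add: vpow_def v_e)

lemma Phi_e_vpow:
  assumes "s < q" "u < q" shows "act (Phi s) (e u) \<in> vpow vL h"
proof -
  have "act (Phi s) (e u) - eps s u * e (u + s) \<in> vpow vL h"
    using Phi_e[OF assms] Q_pos by (auto elim: vpow_mono)
  from vpow_add[OF this OK_vpow[OF eps_OK[OF assms] e_vpow[of "u + s"]]] show ?thesis by simp
qed

lemma R_iff: "\<alpha> \<in> R \<longleftrightarrow> (\<forall>s<q. cA \<alpha> s \<in> Ok)"
proof
  assume \<alpha>: "\<forall>s<q. cA \<alpha> s \<in> Ok"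
  show "\<alpha> \<in> R"
  proof (rule R_I)
    fix x assume x: "x \<in> vpow vL h"
    have cx: "cL x u \<in> Ok" if "u < q" for u using x that vpow_h_iff by blast
    have "act \<alpha> x = act \<alpha> (\<Sum>u<q. cL x u * e u)" by (simp only: L.coord_sum[OF e_basis])
    also have "\<dots> = (\<Sum>u<q. cL x u * act \<alpha> (e u))"
      using cx by (simp add: act_sum_right act_scal_right OK_K)
    also have "\<dots> \<in> vpow vL h"
      unfolding act_eq_sum[of \<alpha>]
      using cx \<alpha> by (intro vpow_sum OK_vpow Phi_e_vpow) auto
    finally show "act \<alpha> x \<in> vpow vL h" .
  qed
next
  assume \<alpha>: "\<alpha> \<in> R"
  show "\<forall>s<q. cA \<alpha> s \<in> Ok"
  proof (rule ccontr)
    assume "\<not> (\<forall>s<q. cA \<alpha> s \<in> Ok)"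
    then obtain s0 where s0: "s0 < q" "cA \<alpha> s0 \<notin> Ok" by blast
    let ?S = "{s. s < q \<and> cA \<alpha> s \<noteq> 0}"
    have s0S: "s0 \<in> ?S" using s0 by auto
    have "\<exists>k\<in>?S. \<forall>s\<in>?S. vL (cA \<alpha> k) \<le> vL (cA \<alpha> s)"
      using s0S by (intro finite_ex_minimum) auto
    then obtain k where k: "k < q" "cA \<alpha> k \<noteq> 0" and min: "\<And>s. s \<in> ?S \<Longrightarrow> vL (cA \<alpha> k) \<le> vL (cA \<alpha> s)"
      by blast
    have "cA \<alpha> k \<notin> Ok"
      using min[OF s0S] s0 k cA_K[of k] cA_K[of s0] by (auto simp: OK_def)
    then have inv: "inverse (cA \<alpha> k) \<in> Pk" using nonintegral_inverse cA_K[OF k(1)] by blast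
    \<comment> \<open>Dividing by a coefficient of least valuation gives an integral element that acts as \<open>0\<close> modulo
      \<open>\<pi>\<close> and has a coefficient \<open>1\<close>.\<close>
    let ?c = "inverse (cA \<alpha> k)" and ?\<beta> = "\<iota> (inverse (cA \<alpha> k)) * \<alpha>"
    have cK: "?c \<in> K" using cA_K[OF k(1)] by (rule K_inverse)
    have c\<beta>: "cA ?\<beta> s = ?c * cA \<alpha> s" if "s < q" for s
      using A.coord_scal[OF Phi_basis cK that] .
    have "cA ?\<beta> k \<in> Pk"
    proof (rule faithful[OF _ _ k(1)])
      fix s assume s: "s < q"
      show "cA ?\<beta> s \<in> Ok"
      proof (cases "cA \<alpha> s = 0")
        case False
        then have "0 \<le> vL (?c * cA \<alpha> s)"
          using min[of s] s k(2) by (simp add: v_mult v_inverse)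
        then show ?thesis using c\<beta>[OF s] K_mult[OF cK cA_K[OF s]] by (simp add: OK_def)
      qed (simp add: c\<beta>[OF s])
    next
      fix u
      have Qc: "?c \<in> vpow vL Q"
      proof -
        obtain m where m: "vL ?c = Q * m" using K_val[OF cK] k(2) by auto
        have "0 < Q * m" using inv k(2) m by (auto simp: PK_def)
        then have "1 \<le> m" using Q_pos by (simp add: zero_less_mult_iff)
        then have "Q * 1 \<le> Q * m" using Q_pos by (intro mult_left_mono) auto
        then show ?thesis using m by (simp add: vpow_def)
      qed
      show "act ?\<beta> (e u) \<in> vpow vL (h + Q)"
        using vpow_mult[OF Qc R_vpow[OF \<alpha> e_vpow]] cK by (simp add: act_scal_left add.commute)
    qed
    then show False using c\<beta>[OF k(1)] k(2) by simp
  qed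
qed

lemma cA_OK: "\<alpha> \<in> R \<Longrightarrow> s < q \<Longrightarrow> cA \<alpha> s \<in> Ok"
  using R_iff by blast

lemma cA_Phi: "s < q \<Longrightarrow> r < q \<Longrightarrow> cA (Phi s) r = (if r = s then 1 else 0)"
  by (rule A.coord_basis[OF Phi_basis])

lemma Phi_R: "s < q \<Longrightarrow> Phi s \<in> R"
  using R_iff cA_Phi by simp

lemma act_1_OK: "\<alpha> \<in> R \<Longrightarrow> act \<alpha> 1 \<in> Ok"
  using cA_OK[OF _ q_pos] by (simp add: cA_0)

text \<open>By \<open>cA_0\<close> the value \<open>act \<beta> 1\<close> is a scalar in
  \<open>K\<close>, and \<open>\<alpha>\<close> acts linearly over \<open>K\<close>.\<close>

lemma act_mult_1:
  assumes "\<beta> \<in> R" shows "act (\<alpha> * \<beta>) 1 = act \<beta> 1 * act \<alpha> 1"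
  using act_scal_right[OF OK_K[OF act_1_OK[OF assms]], of \<alpha> 1] by (simp add: act_mult)

section \<open>Structure constants\<close>

definition tau :: "nat \<Rightarrow> nat \<Rightarrow> nat \<Rightarrow> 'L" where "tau s t r = cA (Phi s * Phi t) r"

lemma tau_OK: "s < q \<Longrightarrow> t < q \<Longrightarrow> r < q \<Longrightarrow> tau s t r \<in> Ok"
  unfolding tau_def by (intro cA_OK R_mult Phi_R)

text \<open>One coordinate of \<open>Phi s * Phi t\<close> applied to \<open>e u\<close> is computed
  twice: from the expansion of the product in the \<open>Phi\<close>, and by letting
  \<open>Phi t\<close> and then \<open>Phi s\<close> act.\<close>

lemma tau_eps:
  assumes s: "s < q" and t: "t < q" and r: "r < q" and u: "u < q" "u + r < q"
  shows "tau s t r * eps r u - (if r = s + t then eps t u * eps s (u + t) else 0) \<in> Pk"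
proof -
  let ?x = "act (Phi t) (e u)"
  let ?c = "cL (act (Phi s * Phi t) (e u)) (u + r)"
  have 1: "?c - tau s t r * eps r u \<in> Pk"
    using act_coord[OF cA_OK[OF R_mult[OF Phi_R[OF s] Phi_R[OF t]]] u(1,2)] by (simp add: tau_def)
  have "act (Phi s) (?x - eps t u * e (u + t)) \<in> vpow vL (h + Q)"
    using Phi_e[OF t u(1)] by (rule R_vpow_Q[OF Phi_R[OF s]])
  then have "cL (act (Phi s) (?x - eps t u * e (u + t))) (u + r) \<in> Pk" using u(2) vpow_h_Q_iff by blast
  moreover have "act (Phi s) (?x - eps t u * e (u + t))
      = act (Phi s * Phi t) (e u) - eps t u * act (Phi s) (e (u + t))"
    using OK_K[OF eps_OK[OF t u(1)]] by (simp add: act_diff_right act_mult act_scal_right)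
  ultimately have 2: "?c - eps t u * cL (act (Phi s) (e (u + t))) (u + r) \<in> Pk"
    using OK_K[OF eps_OK[OF t u(1)]] u(2)
    by (simp add: L.coord_diff[OF e_basis] L.coord_scal[OF e_basis])
  have 3: "eps t u * cL (act (Phi s) (e (u + t))) (u + r)
      - (if r = s + t then eps t u * eps s (u + t) else 0) \<in> Pk"
  proof (cases "u + t < q")
    case True
    have "eps t u * (cL (act (Phi s) (e (u + t))) (u + r)
        - (if u + r = u + t + s then eps s (u + t) else 0)) \<in> Pk"
      by (intro PK_mult_left eps_OK Phi_coord s t u True)
    then show ?thesis by (simp add: right_diff_distrib add.commute split: if_splits)
  next
    case False
    then have "eps t u = 0" using t u by (intro eps_overflow)
    then show ?thesis by simp
  qed
  from PK_add[OF 2 3] have "?c - (if r = s + t then eps t u * eps s (u + t) else 0) \<in> Pk" by simp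
  from PK_diff[OF this 1] show ?thesis by simp
qed

text \<open>At a \<open>u\<close> tight for \<open>r\<close>, the factor \<open>eps r u\<close> in
  \<open>tau_eps\<close> is a unit. Were the other side nonzero, both successive shifts would be
  tight, and adding their increments would give \<open>w r = w s + w t\<close>.\<close>

lemma tau_PK:
  assumes s: "s < q" and t: "t < q" and r: "r < q"
    and not: "\<not> (r = s + t \<and> nc s t \<and> w r = w s + w t)"
  shows "tau s t r \<in> Pk"
proof -
  obtain u where u: "u < q" "tight r u" "u + r < q" using tight_ex[OF r] by blast
  have "(if r = s + t then eps t u * eps s (u + t) else 0) = 0"
  proof (rule ccontr)
    assume *: "(if r = s + t then eps t u * eps s (u + t) else 0) \<noteq> 0"
    then have rst: "r = s + t" and nz: "eps t u \<noteq> 0" "eps s (u + t) \<noteq> 0"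
      by (auto split: if_splits)
    have tu: "tight t u" using nz(1) eps_0[OF t u(1)] by blast
    then have ut: "u + t < q" using nc_less[of t u] t u by (simp add: tight_def add.commute)
    have su: "tight s (u + t)" using nz(2) eps_0[OF s ut] by blast
    have "nc s t" using nocarry_left[of p n t u s] tu su t u by (simp add: tight_def q_def)
    moreover have "w r = w s + w t"
      using tu su u(2) by (simp add: tight_def rst add.commute add.left_commute)
    ultimately show False using not rst by blast
  qed
  then have "tau s t r * eps r u \<in> Pk" using tau_eps[OF s t r u(1,3)] by (simp only: diff_zero)
  then show ?thesis
    using unit_cancel tau_OK[OF s t r] eps_OK[OF r u(1)] eps_unit[OF r u(1,2)] by blast
qed

text \<open>At a \<open>u\<close> tight for \<open>s + t\<close> the increase
  \<open>w s + w t\<close> of \<open>d\<close> splits into two steps bounded below by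
  \<open>w t\<close> and \<open>w s\<close>. Both bounds are equalities, so both factors in
  \<open>tau_eps\<close> are units.\<close>

lemma tau_unit:
  assumes s: "s < q" and t: "t < q" and r: "s + t < q"
    and nc: "nc s t" and w: "w (s + t) = w s + w t"
  shows "tau s t (s + t) \<notin> Pk"
proof -
  obtain u where u: "u < q" "tight (s + t) u" "u + (s + t) < q" using tight_ex[OF r] by blast
  have ncs: "nc t u" "nc s (u + t)"
    using nocarry_assoc[OF nc s[unfolded q_def] t[unfolded q_def] u(1)[unfolded q_def]] u(2)
    by (simp_all add: tight_def)
  have ut: "u + t < q" using nc_less[OF ncs(1) t u(1)] by (simp add: add.commute)
  have "w t \<le> d (u + t) - d u" "w s \<le> d (u + t + s) - d (u + t)"
    using w_le ncs s t u(1) ut by auto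
  moreover have "w s + w t = d (u + t + s) - d u"
    using u(2) w by (simp add: tight_def ac_simps)
  ultimately have "tight t u" "tight s (u + t)" using ncs by (simp_all add: tight_def)
  then have "eps t u * eps s (u + t) \<notin> Pk"
    using unit_mult eps_OK[OF t u(1)] eps_OK[OF s ut] eps_unit[OF t u(1)] eps_unit[OF s ut] by blast
  then have "tau s t (s + t) * eps (s + t) u \<notin> Pk"
    using tau_eps[OF s t r u(1,3)] PK_cong by simp
  then show ?thesis using PK_mult_right eps_OK[OF r u(1)] by blast
qed

lemma cA_mult:
  assumes r: "r < q"
  shows "cA (\<alpha> * \<beta>) r = (\<Sum>s<q. \<Sum>t<q. cA \<alpha> s * cA \<beta> t * tau s t r)"
proof -
  have "\<alpha> * \<beta> = (\<Sum>s<q. \<iota> (cA \<alpha> s) * Phi s) * (\<Sum>t<q. \<iota> (cA \<beta> t) * Phi t)"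
    by (simp only: cA_sum)
  also have "\<dots> = (\<Sum>s<q. \<Sum>t<q. (\<iota> (cA \<alpha> s) * Phi s) * (\<iota> (cA \<beta> t) * Phi t))"
    by (rule sum_product)
  also have "\<dots> = (\<Sum>s<q. \<Sum>t<q. \<iota> (cA \<alpha> s * cA \<beta> t) * (Phi s * Phi t))"
  proof (intro sum.cong refl)
    fix s t assume "s \<in> {..<q}" "t \<in> {..<q}"
    then have K: "cA \<alpha> s \<in> K" "cA \<beta> t \<in> K" by (simp_all add: cA_K)
    have "(\<iota> (cA \<alpha> s) * Phi s) * (\<iota> (cA \<beta> t) * Phi t) = \<iota> (cA \<alpha> s) * (Phi s * \<iota> (cA \<beta> t)) * Phi t"
      by (simp only: mult.assoc)
    also have "\<dots> = \<iota> (cA \<alpha> s) * (\<iota> (cA \<beta> t) * Phi s) * Phi t"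
      by (simp only: iota_commute[OF K(2)])
    finally show "(\<iota> (cA \<alpha> s) * Phi s) * (\<iota> (cA \<beta> t) * Phi t) = \<iota> (cA \<alpha> s * cA \<beta> t) * (Phi s * Phi t)"
      by (simp only: iota_mult[OF K] mult.assoc)
  qed
  finally have eq: "\<alpha> * \<beta> = (\<Sum>s<q. \<Sum>t<q. \<iota> (cA \<alpha> s * cA \<beta> t) * (Phi s * Phi t))" .
  have "cA (\<Sum>s<q. \<Sum>t<q. \<iota> (cA \<alpha> s * cA \<beta> t) * (Phi s * Phi t)) r
      = (\<Sum>s<q. \<Sum>t<q. cA \<alpha> s * cA \<beta> t * tau s t r)"
    by (simp add: A.coord_sum_fun[OF Phi_basis r] A.coord_scal[OF Phi_basis _ r] K_mult cA_K tau_def)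
  then show ?thesis by (simp only: eq)
qed

end

section \<open>Generators of the fractional ideal\<close>

context scaffold_setting
begin

abbreviation "D \<equiv> Dset p n bs h"
abbreviation "E \<equiv> Eset p n bs h"

lemma prec_iff: "preceq p n s u \<Longrightarrow> s < q \<Longrightarrow> u < q \<Longrightarrow> s \<le> u \<and> nc s (u - s)"
  using preceq_diff[of p n s u] p_pos by (simp add: q_def)

lemma preceq_add: "nc s t \<Longrightarrow> s < q \<Longrightarrow> t < q \<Longrightarrow> preceq p n s (s + t)"
  using nocarry_preceq[of p n s t] by (simp add: q_def)

lemma prec_0: "prec p n 0 s \<longleftrightarrow> s \<noteq> 0"
  by (auto simp: prec_def preceq_def)

lemma D_iff: "u \<in> D \<longleftrightarrow> u < q \<and> (\<forall>s<q. s \<noteq> 0 \<and> preceq p n s u \<longrightarrow> d u > d (u - s) + w s)"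
  by (simp add: Dset_def prec_0 q_def)

lemma E_iff: "u \<in> E \<longleftrightarrow> u < q \<and> (\<forall>s<q. s \<noteq> 0 \<and> prec p n s u \<longrightarrow> w u > w (u - s) + w s)"
  by (simp add: Eset_def prec_0 q_def)

lemma D_less: "u \<in> D \<Longrightarrow> s < q \<Longrightarrow> s \<noteq> 0 \<Longrightarrow> preceq p n s u \<Longrightarrow> d (u - s) + w s < d u"
  unfolding D_iff by blast

lemma E_less: "u \<in> E \<Longrightarrow> s < q \<Longrightarrow> s \<noteq> 0 \<Longrightarrow> prec p n s u \<Longrightarrow> w (u - s) + w s < w u"
  unfolding E_iff by blast

lemma D_finite: "finite D" and E_finite: "finite E"
  by (auto intro: finite_subset[of _ "{..<q}"] simp: D_iff E_iff)

text \<open>The inequality defining \<open>D\<close>, taken at \<open>s = v - u\<close>, is the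
  strict form of the bound that tightness would make an equality.\<close>

lemma D_not_tight:
  assumes v: "v \<in> D" and "u < v"
  shows "\<not> tight (v - u) u"
proof
  assume t: "tight (v - u) u"
  have vq: "v < q" using v by (simp add: D_iff)
  have "preceq p n (v - u) (v - u + u)"
    using t vq assms(2) by (intro preceq_add) (auto simp: tight_def)
  then have "d (v - (v - u)) + w (v - u) < d v" using v vq assms(2) by (intro D_less) auto
  then show False using t assms(2) by (simp add: tight_def)
qed

text \<open>By \<open>D_not_tight\<close> row \<open>v\<close> of the matrix of
  \<open>\<alpha>\<close> modulo \<open>Pk\<close> vanishes off the diagonal, so on the coordinates
  in \<open>D\<close> the order acts through its residue field.\<close>

lemma D_coord:
  assumes \<alpha>: "\<alpha> \<in> R" and x: "x \<in> vpow vL h" and v: "v \<in> D"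
  shows "cL (act \<alpha> x) v - act \<alpha> 1 * cL x v \<in> Pk"
proof -
  have vq: "v < q" using v by (simp add: D_iff)
  have cx: "cL x u \<in> Ok" if "u < q" for u using x that vpow_h_iff by blast
  have "act \<alpha> x = act \<alpha> (\<Sum>u<q. cL x u * e u)" by (simp only: L.coord_sum[OF e_basis])
  also have "\<dots> = (\<Sum>u<q. cL x u * act \<alpha> (e u))"
    using cx by (simp add: act_sum_right act_scal_right OK_K)
  finally have "cL (act \<alpha> x) v = (\<Sum>u<q. cL x u * cL (act \<alpha> (e u)) v)"
    using cx by (simp add: L.coord_sum_fun[OF e_basis vq] L.coord_scal[OF e_basis _ vq] OK_K)
  moreover have "(\<Sum>u<q. cL x u * cL (act \<alpha> (e u)) v) - act \<alpha> 1 * cL x v \<in> Pk"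
  proof (rule sum_single_cong[where k = v])
    fix u assume u: "u \<in> {..<q}" "u \<noteq> v"
    have "eps (v - u) u = 0" if "u \<le> v"
      using D_not_tight[OF v] eps_0[of "v - u" u] that u vq by auto
    then have "cL (act \<alpha> (e u)) v \<in> Pk"
      using act_coord[OF cA_OK[OF \<alpha>] _ vq, of u] u by (auto split: if_splits)
    then show "cL x u * cL (act \<alpha> (e u)) v \<in> Pk" using cx u by (intro PK_mult_left) auto
  next
    have "cL (act \<alpha> (e v)) v - cA \<alpha> 0 * eps 0 v \<in> Pk"
      using act_coord[OF cA_OK[OF \<alpha>] vq vq] by simp
    moreover have "cA \<alpha> 0 * (eps 0 v - 1) \<in> Pk"
      by (intro PK_mult_left cA_OK \<alpha> q_pos eps_zero_left vq)
    ultimately have "cL (act \<alpha> (e v)) v - cA \<alpha> 0 \<in> Pk"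
      using PK_add by (fastforce simp: right_diff_distrib)
    from PK_mult_left[OF cx[OF vq] this]
    show "cL x v * cL (act \<alpha> (e v)) v - act \<alpha> 1 * cL x v \<in> Pk"
      by (simp add: cA_0 right_diff_distrib mult.commute)
  qed (use vq in auto)
  ultimately show ?thesis by simp
qed

text \<open>With fewer than \<open>card D\<close> generators, \<open>unit_solution\<close> yields a
  combination of the \<open>e u\<close>, nontrivial modulo \<open>Pk\<close>, whose coefficients at
  the generators vanish at 1. By \<open>D_coord\<close> its coordinates in \<open>D\<close> lie in
  \<open>Pk\<close>, yet they are the \<open>x v\<close>.\<close>

lemma generators_lower_bound:
  assumes "generated_by act R (vpow vL h) m"
  shows "card D \<le> m"
proof (rule ccontr)
  assume "\<not> card D \<le> m"
  then have m: "m < card D" by simp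
  obtain g where g: "\<And>i. i < m \<Longrightarrow> g i \<in> vpow vL h"
    and gen: "vpow vL h = {\<Sum>i<m. act (\<alpha> i) (g i) | \<alpha>. \<forall>i<m. \<alpha> i \<in> R}"
    using assms unfolding generated_by_def by blast
  have "\<forall>u. \<exists>\<alpha>. (\<forall>i<m. \<alpha> i \<in> R) \<and> e u = (\<Sum>i<m. act (\<alpha> i) (g i))"
  proof
    fix u
    have "e u \<in> {\<Sum>i<m. act (\<alpha> i) (g i) | \<alpha>. \<forall>i<m. \<alpha> i \<in> R}"
      using e_vpow[of u] unfolding gen .
    then show "\<exists>\<alpha>. (\<forall>i<m. \<alpha> i \<in> R) \<and> e u = (\<Sum>i<m. act (\<alpha> i) (g i))" by blast
  qed
  from choice[OF this] obtain \<alpha> where \<alpha>R: "\<And>u i. i < m \<Longrightarrow> \<alpha> u i \<in> R"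
    and \<alpha>: "\<And>u. e u = (\<Sum>i<m. act (\<alpha> u i) (g i))" by blast
  obtain x where x: "\<forall>u\<in>D. x u \<in> Ok" "\<exists>u\<in>D. x u \<notin> Pk"
    "\<forall>i<m. (\<Sum>u\<in>D. x u * act (\<alpha> u i) 1) = 0"
    using unit_solution[OF D_finite m, of "\<lambda>u i. act (\<alpha> u i) 1"] \<alpha>R act_1_OK OK_K by blast
  have "x v \<in> Pk" if v: "v \<in> D" for v
  proof -
    have vq: "v < q" using v by (simp add: D_iff)
    have congr: "cL (e u) v - (\<Sum>i<m. act (\<alpha> u i) 1 * cL (g i) v) \<in> Pk" for u
    proof -
      have "cL (e u) v = (\<Sum>i<m. cL (act (\<alpha> u i) (g i)) v)"
        by (subst \<alpha>) (rule L.coord_sum_fun[OF e_basis vq])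
      then have "cL (e u) v - (\<Sum>i<m. act (\<alpha> u i) 1 * cL (g i) v)
          = (\<Sum>i<m. cL (act (\<alpha> u i) (g i)) v - act (\<alpha> u i) 1 * cL (g i) v)"
        by (simp only: sum_subtractf)
      also have "\<dots> \<in> Pk" using \<alpha>R g v by (intro PK_sum D_coord) auto
      finally show ?thesis .
    qed
    have "(\<Sum>u\<in>D. x u * (cL (e u) v - (\<Sum>i<m. act (\<alpha> u i) 1 * cL (g i) v))) \<in> Pk"
      using x(1) congr by (intro PK_sum PK_mult_left) auto
    moreover have "(\<Sum>u\<in>D. x u * (cL (e u) v - (\<Sum>i<m. act (\<alpha> u i) 1 * cL (g i) v)))
        = (\<Sum>u\<in>D. x u * cL (e u) v) - (\<Sum>u\<in>D. \<Sum>i<m. x u * act (\<alpha> u i) 1 * cL (g i) v)"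
      by (simp add: right_diff_distrib sum_subtractf sum_distrib_left mult.assoc)
    moreover have "(\<Sum>u\<in>D. \<Sum>i<m. x u * act (\<alpha> u i) 1 * cL (g i) v)
        = (\<Sum>i<m. (\<Sum>u\<in>D. x u * act (\<alpha> u i) 1) * cL (g i) v)"
      by (subst sum.swap) (simp add: sum_distrib_right)
    moreover have "\<dots> = 0" using x(3) by simp
    moreover have "(\<Sum>u\<in>D. x u * cL (e u) v) = (\<Sum>u\<in>{v}. x u)"
      using D_finite v by (intro sum.mono_neutral_cong_right)
        (auto simp: D_iff L.coord_basis[OF e_basis _ vq])
    ultimately show ?thesis by simp
  qed
  then show False using x(2) by blast
qed

text \<open>Induction on \<open>u\<close>, modulo \<open>Pk\<close>: for \<open>u \<notin> D\<close>
  some tight pair \<open>s\<close>, \<open>u - s\<close> makes \<open>e u\<close> a unit multiple of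
  the image of \<open>e (u - s)\<close> under \<open>Phi s\<close>. Nakayama then removes the
  congruence.\<close>

lemma D_generates: "generated_by act R (vpow vL h) (card D)"
proof -
  obtain \<sigma> where \<sigma>: "bij_betw \<sigma> {..<card D} D"
    using ex_bij_betw_nat_finite[OF D_finite] by (auto simp: atLeast0LessThan)
  let ?m = "card D"
  let ?g = "\<lambda>i. e (\<sigma> i)"
  let ?Y = "{\<Sum>i<?m. act (\<alpha> i) (?g i) | \<alpha>. \<forall>i<?m. \<alpha> i \<in> R}"
  have YI: "(\<Sum>i<?m. act (\<alpha> i) (?g i)) \<in> ?Y" if "\<And>i. i < ?m \<Longrightarrow> \<alpha> i \<in> R" for \<alpha>
    using that by blast
  have Ysub: "?Y \<subseteq> vpow vL h"
    by (auto intro!: vpow_sum R_vpow e_vpow)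
  have Yact: "act \<beta> y \<in> ?Y" if \<beta>: "\<beta> \<in> R" and y: "y \<in> ?Y" for \<beta> y
  proof -
    obtain \<alpha> where \<alpha>: "\<forall>i<?m. \<alpha> i \<in> R" "y = (\<Sum>i<?m. act (\<alpha> i) (?g i))" using y by blast
    have "act \<beta> y = (\<Sum>i<?m. act (\<beta> * \<alpha> i) (?g i))"
      by (simp add: \<alpha>(2) act_sum_right act_mult)
    then show ?thesis using YI[of "\<lambda>i. \<beta> * \<alpha> i"] \<alpha>(1) \<beta> R_mult by simp
  qed
  have Y: "L.submod ?Y"
    unfolding L.submod_def
  proof (intro conjI ballI)
    show "0 \<in> ?Y" using YI[of "\<lambda>_. 0"] R_0 by simp
    show "x + y \<in> ?Y" if x: "x \<in> ?Y" and y: "y \<in> ?Y" for x y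
    proof -
      obtain \<alpha> where \<alpha>: "\<forall>i<?m. \<alpha> i \<in> R" "x = (\<Sum>i<?m. act (\<alpha> i) (?g i))"
        using x by blast
      obtain \<beta> where \<beta>: "\<forall>i<?m. \<beta> i \<in> R" "y = (\<Sum>i<?m. act (\<beta> i) (?g i))"
        using y by blast
      have "x + y = (\<Sum>i<?m. act (\<alpha> i + \<beta> i) (?g i))"
        by (simp add: \<alpha>(2) \<beta>(2) act_add_left sum.distrib)
      then show ?thesis using YI[of "\<lambda>i. \<alpha> i + \<beta> i"] \<alpha>(1) \<beta>(1) R_add by simp
    qed
    show "c * x \<in> ?Y" if "c \<in> Ok" "x \<in> ?Y" for c x
      using Yact[OF R_iota[OF that(1)] that(2)] that(1) by (simp add: act_iota OK_K)
  qed
  have e_near: "u < q \<Longrightarrow> e u \<in> L.near q e ?Y" for u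
  proof (induction u rule: less_induct)
    case (less u)
    show ?case
    proof (cases "u \<in> D")
      case True
      then have "u \<in> \<sigma> ` {..<?m}" using \<sigma> by (simp add: bij_betw_def)
      then obtain k where k: "k < ?m" "u = \<sigma> k" by auto
      have "(\<Sum>i<?m. act (if i = k then 1 else 0) (?g i)) = (\<Sum>i\<in>{k}. ?g i)"
        using k(1) by (intro sum.mono_neutral_cong_right) auto
      then have "e u \<in> ?Y" using YI[of "\<lambda>i. if i = k then 1 else 0"] R_0 R_1 k(2) by simp
      then show ?thesis using L.subset_near[OF e_basis Y] by blast
    next
      case False
      then obtain s where s: "s < q" "s \<noteq> 0" "preceq p n s u" "d u \<le> d (u - s) + w s"
        using less.prems by (auto simp: D_iff not_less)
      have le: "s \<le> u" and nc: "nc s (u - s)" using prec_iff[OF s(3,1) less.prems] by auto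
      let ?t = "u - s"
      have t: "?t < u" "?t < q" using le s(2) less.prems by auto
      \<comment> \<open>The failed inequality bounds the increase of \<open>d\<close> from above by
        \<open>w s\<close>, and minimality of \<open>w s\<close> bounds it from below.\<close>
      have tight: "tight s ?t"
        using w_le[OF nc s(1) t(2)] nc le s(4) by (simp add: tight_def)
      obtain y where y: "y \<in> ?Y" "\<forall>j<q. cL (e ?t - y) j \<in> Pk"
        using less.IH[OF t] unfolding L.near_def by blast
      have "act (Phi s) (e ?t - y) \<in> vpow vL (h + Q)"
        using y(2) by (intro R_vpow_Q Phi_R s(1)) (simp only: vpow_h_Q_iff)
      from vpow_diff[OF this Phi_e[OF s(1) t(2)]]
      have "eps s ?t * e u - act (Phi s) y \<in> vpow vL (h + Q)"
        using le by (simp add: act_diff_right)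
      then have "\<forall>j<q. cL (eps s ?t * e u - act (Phi s) y) j \<in> Pk" by (simp only: vpow_h_Q_iff)
      then have "eps s ?t * e u \<in> L.near q e ?Y"
        using Yact[OF Phi_R[OF s(1)] y(1)] unfolding L.near_def by blast
      then show ?thesis
        using L.near_unit_scal[OF e_basis Y eps_OK[OF s(1) t(2)] eps_unit[OF s(1) t(2) tight]]
        by blast
    qed
  qed
  have "vpow vL h \<subseteq> ?Y"
    using L.nakayama_near[OF e_basis Y e_near] vpow_h_iff by blast
  then show ?thesis
    unfolding generated_by_def using Ysub e_vpow by (intro exI[of _ ?g] conjI) auto
qed

section \<open>The maximal ideal\<close>

definition M :: "'A set" where "M = {\<alpha> \<in> R. act \<alpha> 1 \<in> Pk}"

lemma M_R: "\<alpha> \<in> M \<Longrightarrow> \<alpha> \<in> R" and M_act: "\<alpha> \<in> M \<Longrightarrow> act \<alpha> 1 \<in> Pk"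
  by (simp_all add: M_def)

lemma M_add: "\<alpha> \<in> M \<Longrightarrow> \<beta> \<in> M \<Longrightarrow> \<alpha> + \<beta> \<in> M"
  by (simp add: M_def R_add act_add_left PK_add)

lemma M_mult_left: "\<alpha> \<in> R \<Longrightarrow> \<beta> \<in> M \<Longrightarrow> \<alpha> * \<beta> \<in> M"
  by (simp add: M_def R_mult act_mult_1 act_1_OK PK_mult_right)

lemma iota_M: "c \<in> Ok \<Longrightarrow> \<iota> c \<in> M \<longleftrightarrow> c \<in> Pk"
  by (simp add: M_def R_iota act_iota OK_K)

lemma R_subring: "is_subring R"
  by (simp add: is_subring_def R_0 R_1 R_add R_mult R_uminus)

lemma M_left_ideal: "left_ideal R M"
proof -
  have "0 \<in> M" by (simp add: M_def R_0)
  moreover have "- x \<in> M" if "x \<in> M" for x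
    using M_mult_left[OF R_iota[OF OK_m1] that] by (simp add: uminus_eq)
  ultimately show ?thesis
    unfolding left_ideal_def using M_R M_add M_mult_left by blast
qed

lemma left_ideal_submod:
  assumes "left_ideal R J" shows "A.submod J"
  using assms R_iota unfolding left_ideal_def A.submod_def by blast

text \<open>Modulo \<open>\<pi>\<close>, \<open>\<Phi>\<^sub>s \<alpha>\<close> is a unit multiple of \<open>\<Phi>\<^sub>s\<close> plus terms \<open>\<Phi>\<^sub>r\<close> with \<open>r > s\<close>, so descending induction on
  \<open>s\<close> puts every \<open>\<Phi>\<^sub>s\<close> into \<open>J + \<pi> R\<close>.\<close>
lemma left_ideal_eq_R:
  assumes J: "left_ideal R J" and \<alpha>: "\<alpha> \<in> J" "act \<alpha> 1 \<notin> Pk"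
  shows "J = R"
proof -
  have JR: "J \<subseteq> R" and Jmult: "\<And>r x. r \<in> R \<Longrightarrow> x \<in> J \<Longrightarrow> r * x \<in> J"
    using J by (auto simp: left_ideal_def)
  have \<alpha>R: "\<alpha> \<in> R" using \<alpha>(1) JR by blast
  note sJ = left_ideal_submod[OF J]
  note sN = A.near_submod[OF Phi_basis sJ]
  have near: "\<forall>r. s \<le> r \<longrightarrow> r < q \<longrightarrow> Phi r \<in> A.near q Phi J" if "s \<le> q" for s
    using that
  proof (induction s rule: inc_induct)
    case base
    then show ?case by simp
  next
    case (step s)
    then have s: "s < q" by simp
    let ?b = "\<lambda>r. cA (Phi s * \<alpha>) r"
    have bR: "Phi s * \<alpha> \<in> R" by (intro R_mult Phi_R s \<alpha>R)
    have b: "?b r - (if s \<le> r then cA \<alpha> (r - s) * tau s (r - s) r else 0) \<in> Pk" if r: "r < q" for r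
    proof -
      have "?b r = (\<Sum>s'<q. \<Sum>t<q. cA (Phi s) s' * cA \<alpha> t * tau s' t r)" by (rule cA_mult[OF r])
      also have "\<dots> = (\<Sum>s'\<in>{s}. \<Sum>t<q. cA \<alpha> t * tau s' t r)"
        using s by (intro sum.mono_neutral_cong_right) (auto simp: cA_Phi)
      finally have br: "?b r = (\<Sum>t<q. cA \<alpha> t * tau s t r)" by simp
      have trm: "cA \<alpha> t * tau s t r \<in> Pk" if "t < q" "r \<noteq> s + t" for t
        using that s r by (intro PK_mult_left cA_OK \<alpha>R tau_PK) auto
      show ?thesis
      proof (cases "s \<le> r")
        case True
        have "(\<Sum>t<q. cA \<alpha> t * tau s t r) - cA \<alpha> (r - s) * tau s (r - s) r \<in> Pk"
          using True r trm by (intro sum_single_cong[where k = "r - s"]) auto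
        then show ?thesis using True br by simp
      next
        case False
        have "(\<Sum>t<q. cA \<alpha> t * tau s t r) \<in> Pk"
          using False trm by (intro PK_sum) auto
        then show ?thesis using False br by simp
      qed
    qed
    \<comment> \<open>As \<open>Phi 0 = 1\<close>, the coefficient at \<open>Phi s\<close> is
      congruent to \<open>act \<alpha> 1\<close>, a unit by assumption.\<close>
    have tau1: "tau s 0 s = 1" using s by (simp add: tau_def Phi_0 cA_Phi)
    have bs: "?b s \<in> Ok" "?b s \<notin> Pk"
      using cA_OK[OF bR s] b[OF s] \<alpha>(2) PK_cong[of "?b s" "act \<alpha> 1"] by (simp_all add: tau1 cA_0)
    have "Phi s * \<alpha> = (\<Sum>r<q. \<iota> (?b r) * Phi r)" by (simp only: cA_sum)
    also have "\<dots> = \<iota> (?b s) * Phi s + (\<Sum>r\<in>{..<q} - {s}. \<iota> (?b r) * Phi r)"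
      using s by (intro sum.remove) auto
    finally have eq: "\<iota> (?b s) * Phi s = Phi s * \<alpha> + \<iota> (- 1) * (\<Sum>r\<in>{..<q} - {s}. \<iota> (?b r) * Phi r)"
      unfolding uminus_eq[symmetric] add_uminus_conv_diff eq_diff_eq by (rule sym)
    have "Phi s * \<alpha> \<in> A.near q Phi J"
      using Jmult[OF Phi_R[OF s] \<alpha>(1)] A.subset_near[OF Phi_basis sJ] by blast
    moreover have "(\<Sum>r\<in>{..<q} - {s}. \<iota> (?b r) * Phi r) \<in> A.near q Phi J"
    proof (rule A.submod_sum[OF sN])
      fix r assume r: "r \<in> {..<q} - {s}"
      have brO: "?b r \<in> Ok" using cA_OK[OF bR] r by simp
      show "\<iota> (?b r) * Phi r \<in> A.near q Phi J"
      proof (cases "s < r")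
        case True
        then show ?thesis using step.IH r brO by (intro A.submod_scal[OF sN]) auto
      next
        case False
        then have "?b r \<in> Pk" using b[of r] r by auto
        then show ?thesis
          using r by (intro A.near_coord[OF Phi_basis sJ])
            (auto simp: A.coord_scal[OF Phi_basis] PK_OK OK_K cA_Phi)
      qed
    qed
    ultimately have "\<iota> (?b s) * Phi s \<in> A.near q Phi J"
      unfolding eq by (intro A.submod_add[OF sN] A.submod_scal[OF sN] OK_m1)
    then have "Phi s \<in> A.near q Phi J" by (rule A.near_unit_scal[OF Phi_basis sJ bs])
    then show ?case using step.IH by (metis Suc_leI le_neq_implies_less)
  qed
  have "R \<subseteq> J"
    using A.nakayama_near[OF Phi_basis sJ] near[of 0] cA_OK by blast
  then show ?thesis using JR by blast
qed

lemma M_ne_R: "M \<noteq> R"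
proof -
  have "1 \<notin> M" by (simp add: M_def)
  then show ?thesis using R_1 by blast
qed

lemma left_ideal_subset_M: "left_ideal R J \<Longrightarrow> J \<noteq> R \<Longrightarrow> J \<subseteq> M"
  using left_ideal_eq_R[of J] unfolding M_def left_ideal_def by blast

lemma M_max: "max_left_ideal R M"
  unfolding max_left_ideal_def using M_left_ideal M_ne_R left_ideal_subset_M by blast

lemma M_unique: "max_left_ideal R M' \<Longrightarrow> M' = M"
  using left_ideal_subset_M M_left_ideal M_ne_R unfolding max_left_ideal_def by metis

section \<open>The square of the maximal ideal\<close>

lemma ideal_sq_I:
  fixes k :: nat
  shows "\<forall>i<k. x i \<in> M \<and> y i \<in> M \<Longrightarrow> (\<Sum>i<k. x i * y i) \<in> ideal_sq M"
  unfolding ideal_sq_def by (intro CollectI exI[of _ k] exI[of _ x] exI[of _ y]) simp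

lemma ideal_sq_mult: "x \<in> M \<Longrightarrow> y \<in> M \<Longrightarrow> x * y \<in> ideal_sq M"
  using ideal_sq_I[of 1 "\<lambda>_. x" "\<lambda>_. y"] by simp

lemma ideal_sq_add:
  assumes "a \<in> ideal_sq M" "b \<in> ideal_sq M" shows "a + b \<in> ideal_sq M"
proof -
  obtain k x y where a: "a = (\<Sum>i<k. x i * y i)" "\<forall>i<(k::nat). x i \<in> M \<and> y i \<in> M"
    using assms(1) unfolding ideal_sq_def by blast
  obtain l x' y' where b: "b = (\<Sum>i<l. x' i * y' i)" "\<forall>i<(l::nat). x' i \<in> M \<and> y' i \<in> M"
    using assms(2) unfolding ideal_sq_def by blast
  let ?x = "\<lambda>i. if i < k then x i else x' (i - k)"
  let ?y = "\<lambda>i. if i < k then y i else y' (i - k)"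
  have "(\<Sum>i<k + j. ?x i * ?y i) = a + (\<Sum>i<j. x' i * y' i)" for j
    by (induction j) (simp_all add: a(1) add.assoc)
  from this[of l] have "a + b = (\<Sum>i<k + l. ?x i * ?y i)" by (simp only: b(1))
  moreover have "\<forall>i<k + l. ?x i \<in> M \<and> ?y i \<in> M" using a(2) b(2) by auto
  ultimately show ?thesis using ideal_sq_I[of "k + l" ?x ?y] by simp
qed

lemma ideal_sq_submod: "A.submod (ideal_sq M)"
  unfolding A.submod_def
proof (intro conjI ballI)
  show "0 \<in> ideal_sq M" using ideal_sq_I[of 0] by simp
  show "c \<in> Ok \<Longrightarrow> a \<in> ideal_sq M \<Longrightarrow> \<iota> c * a \<in> ideal_sq M" for c a
  proof -
    assume c: "c \<in> Ok" and "a \<in> ideal_sq M"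
    then obtain k x y where a: "a = (\<Sum>i<k. x i * y i)" "\<forall>i<(k::nat). x i \<in> M \<and> y i \<in> M"
      unfolding ideal_sq_def by blast
    have "\<iota> c * a = (\<Sum>i<k. (\<iota> c * x i) * y i)"
      by (simp add: a(1) sum_distrib_left mult.assoc)
    moreover have "\<forall>i<k. \<iota> c * x i \<in> M \<and> y i \<in> M" using a(2) M_mult_left[OF R_iota[OF c]] by blast
    ultimately show ?thesis using ideal_sq_I[of k "\<lambda>i. \<iota> c * x i" y] by simp
  qed
qed (rule ideal_sq_add)

lemma Phi_M: "s < q \<Longrightarrow> s \<noteq> 0 \<Longrightarrow> Phi s \<in> M"
  by (simp add: M_def Phi_R Phi_act_1)

text \<open>Evaluation at 1 is multiplicative and sends \<open>M\<close> to elements of valuation at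
  least \<open>Q\<close>. This separates \<open>pw 1\<close>, of valuation \<open>Q\<close>, from
  the square.\<close>

lemma ideal_sq_act_1:
  assumes "x \<in> ideal_sq M"
  shows "act x 1 \<in> vpow vL (2 * Q)"
proof -
  have PQ: "c \<in> vpow vL Q" if c: "c \<in> Pk" for c
  proof (cases "c = 0")
    case False
    obtain k where k: "vL c = Q * k" using K_val[OF OK_K[OF PK_OK[OF c]] False] by blast
    then have "1 \<le> k" using c False Q_pos by (auto simp: PK_def zero_less_mult_iff)
    then have "Q * 1 \<le> Q * k" using Q_pos by (intro mult_left_mono) auto
    then show ?thesis using k by (simp add: vpow_def)
  qed simp
  obtain k y z where x: "x = (\<Sum>i<k. y i * z i)" "\<forall>i<(k::nat). y i \<in> M \<and> z i \<in> M"
    using assms unfolding ideal_sq_def by blast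
  show ?thesis
    unfolding x(1) act_sum_left
  proof (rule vpow_sum)
    fix i assume "i \<in> {..<k}"
    then have i: "y i \<in> M" "z i \<in> M" using x(2) by auto
    show "act (y i * z i) 1 \<in> vpow vL (2 * Q)"
      using vpow_mult[OF PQ[OF M_act[OF i(2)]] PQ[OF M_act[OF i(1)]]]
      by (simp add: act_mult_1 M_R i)
  qed
qed

text \<open>In \<open>cA_mult\<close> a term with \<open>s = 0\<close> or \<open>t = 0\<close> has a
  coefficient in \<open>Pk\<close> because both factors lie in \<open>M\<close>. For the other terms
  \<open>r \<in> E\<close> excludes a carry-free splitting with additive \<open>w\<close>, so
  \<open>tau_PK\<close> applies.\<close>

lemma ideal_sq_coord:
  assumes "x \<in> ideal_sq M" "r \<in> E" "r \<noteq> 0"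
  shows "cA x r \<in> Pk"
proof -
  have r: "r < q" using assms(2) by (simp add: E_iff)
  have *: "cA (y * z) r \<in> Pk" if y: "y \<in> M" and z: "z \<in> M" for y z
    unfolding cA_mult[OF r]
  proof (intro PK_sum)
    fix s t assume "s \<in> {..<q}" "t \<in> {..<q}"
    then have s: "s < q" and t: "t < q" by auto
    have O: "cA y s \<in> Ok" "cA z t \<in> Ok" "tau s t r \<in> Ok"
      using cA_OK[OF M_R[OF y] s] cA_OK[OF M_R[OF z] t] tau_OK[OF s t r] .
    show "cA y s * cA z t * tau s t r \<in> Pk"
    proof (cases "s = 0 \<or> t = 0")
      case True
      then have "cA y s * cA z t \<in> Pk"
        using O M_act[OF y] M_act[OF z] by (auto simp: cA_0 intro: PK_mult_left PK_mult_right)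
      then show ?thesis using O(3) by (rule PK_mult_right)
    next
      case False
      have "\<not> (r = s + t \<and> nc s t \<and> w r = w s + w t)"
      proof
        assume *: "r = s + t \<and> nc s t \<and> w r = w s + w t"
        then have "prec p n s r" using preceq_add[of s t] s t False by (simp add: prec_def)
        then have "w (r - s) + w s < w r" using assms(2) s False by (intro E_less) auto
        then show False using * by auto
      qed
      then have "tau s t r \<in> Pk" by (rule tau_PK[OF s t r])
      then show ?thesis using OK_mult[OF O(1,2)] by (intro PK_mult_left)
    qed
  qed
  obtain k y z where x: "x = (\<Sum>i<k. y i * z i)" "\<forall>i<(k::nat). y i \<in> M \<and> z i \<in> M"
    using assms(1) unfolding ideal_sq_def by blast
  show ?thesis unfolding x(1) A.coord_sum_fun[OF Phi_basis r] using x(2) * by (intro PK_sum) auto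
qed

lemma scal_Phi_ideal_sq: "c \<in> Pk \<Longrightarrow> s < q \<Longrightarrow> s \<noteq> 0 \<Longrightarrow> \<iota> c * Phi s \<in> ideal_sq M"
  by (intro ideal_sq_mult Phi_M) (simp add: iota_M PK_OK)

text \<open>A failed inequality splits \<open>r\<close> without carry into nonzero \<open>s\<close>
  and \<open>t\<close> with \<open>w r = w s + w t\<close>. Then \<open>Phi s * Phi t\<close> is a
  unit multiple of \<open>Phi r\<close> up to multiples of other \<open>Phi i\<close> by elements of
  \<open>Pk\<close>, themselves in the square for \<open>i \<noteq> 0\<close>.\<close>

lemma Phi_ideal_sq:
  assumes r: "r < q" "r \<notin> E"
  shows "Phi r \<in> ideal_sq M"
proof -
  obtain s where s: "s < q" "s \<noteq> 0" "prec p n s r" "w r \<le> w (r - s) + w s"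
    using r by (auto simp: E_iff not_less)
  have le: "s \<le> r" and nc: "nc s (r - s)" and ne: "s \<noteq> r"
    using prec_iff[of s r] s r by (auto simp: prec_def)
  define t where "t = r - s"
  have t: "t < q" "t \<noteq> 0" and rst: "r = s + t" using r le ne by (auto simp: t_def)
  have nct: "nc s t" using nc by (simp add: t_def)
  have r0: "r \<noteq> 0" using s(2) le by simp
  \<comment> \<open>Shifting by \<open>t\<close> and then by \<open>s\<close> from a
    \<open>u\<close> that realizes \<open>w r\<close> shows that \<open>w\<close> is superadditive
    on carry-free sums; the failed inequality gives the converse.\<close>
  have wr: "w (s + t) = w s + w t"
  proof -
    obtain u where u: "u < q" "nc r u" "w r = d (u + r) - d u" using w_attained[OF r(1)] by blast
    have ncs: "nc t u" "nc s (u + t)"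
      using nocarry_assoc[OF nct s(1)[unfolded q_def] t(1)[unfolded q_def] u(1)[unfolded q_def]] u(2)
      by (simp_all add: rst)
    have ut: "u + t < q" using nc_less[OF ncs(1) t(1) u(1)] by (simp add: add.commute)
    have "w t \<le> d (u + t) - d u" "w s \<le> d (u + t + s) - d (u + t)"
      using w_le ncs s(1) t(1) u(1) ut by auto
    moreover have "w r = d (u + t + s) - d u" using u(3) by (simp add: rst ac_simps)
    ultimately show ?thesis using s(4) by (simp add: rst)
  qed
  have a: "tau s t r \<in> Ok" "tau s t r \<notin> Pk"
    using tau_OK[OF s(1) t(1) r(1)] tau_unit[OF s(1) t(1) _ nct wr] r(1) by (simp_all add: rst)
  have "Phi s * Phi t = (\<Sum>i<q. \<iota> (tau s t i) * Phi i)" by (simp only: tau_def cA_sum)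
  also have "\<dots> = \<iota> (tau s t r) * Phi r + (\<Sum>i\<in>{..<q} - {r}. \<iota> (tau s t i) * Phi i)"
    using r(1) by (intro sum.remove) auto
  finally have eq: "\<iota> (tau s t r) * Phi r
      = Phi s * Phi t + \<iota> (- 1) * (\<Sum>i\<in>{..<q} - {r}. \<iota> (tau s t i) * Phi i)"
    unfolding uminus_eq[symmetric] add_uminus_conv_diff eq_diff_eq by (rule sym)
  have err: "\<iota> (tau s t i) * Phi i \<in> ideal_sq M" if i: "i \<in> {..<q} - {r}" for i
  proof (cases "i = 0")
    case True
    \<comment> \<open>For index 0 a coefficient in \<open>Pk\<close> would give only an element of
      \<open>M\<close>. It vanishes exactly because \<open>Phi t\<close> kills 1.\<close>
    have "tau s t 0 = 0" by (simp add: tau_def cA_0 act_mult Phi_act_1 t)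
    then show ?thesis using True A.submod_0[OF ideal_sq_submod] by simp
  next
    case False
    then show ?thesis using i rst s(1) t(1) by (intro scal_Phi_ideal_sq tau_PK) auto
  qed
  have "\<iota> (tau s t r) * Phi r \<in> ideal_sq M"
    unfolding eq using s(1,2) t err
    by (intro A.submod_add[OF ideal_sq_submod] A.submod_scal[OF ideal_sq_submod OK_m1]
        A.submod_sum[OF ideal_sq_submod] ideal_sq_mult[OF Phi_M Phi_M])
  from A.submod_scal[OF ideal_sq_submod unit_inverse[OF a] this] show ?thesis
    using OK_K[OF a(1)] unit_nonzero[OF a(2)] by (simp add: A.scal_scal K_inverse)
qed

text \<open>The basis consists of the classes of \<open>pw 1\<close> and of \<open>Phi r\<close> for
  nonzero \<open>r \<in> E\<close>. It spans by \<open>Phi_ideal_sq\<close>; independence follows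
  from \<open>ideal_sq_coord\<close> at nonzero \<open>r\<close> and from
  \<open>ideal_sq_act_1\<close> at 0.\<close>

lemma embedding_dimension: "kappa_dim_quot \<iota> Ok Pk M (card E)"
proof -
  obtain \<sigma> where \<sigma>: "bij_betw \<sigma> {..<card E} E"
    using ex_bij_betw_nat_finite[OF E_finite] by (auto simp: atLeast0LessThan)
  have E0: "0 \<in> E" using q_pos prec_iff[of _ 0] by (auto simp: E_iff prec_def)
  let ?m = "card E"
  have pw1: "pw 1 \<in> Pk" using pw_K Q_pos by (simp add: PK_def pw_nonzero v_pw)
  \<comment> \<open>\<open>0\<close> always lies in \<open>E\<close> and stands for the generator \<open>\<pi>\<close>.\<close>
  define F where "F r = (if r = 0 then \<iota> (pw 1) else Phi r)" for r
  have FM: "F r \<in> M" if "r \<in> E" for r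
    using that pw1 by (simp add: F_def iota_M PK_OK Phi_M E_iff)
  have reindex: "(\<Sum>i<?m. \<iota> (c i) * F (\<sigma> i)) = (\<Sum>r\<in>E. \<iota> (c (inv_into {..<?m} \<sigma> r)) * F r)" for c
  proof -
    have "(\<Sum>i<?m. \<iota> (c i) * F (\<sigma> i))
        = (\<Sum>i<?m. \<iota> (c (inv_into {..<?m} \<sigma> (\<sigma> i))) * F (\<sigma> i))"
      using \<sigma> by (intro sum.cong refl) (simp add: bij_betw_inv_into_left)
    also have "\<dots> = (\<Sum>r\<in>E. \<iota> (c (inv_into {..<?m} \<sigma> r)) * F r)"
      by (rule sum.reindex_bij_betw[OF \<sigma>])
    finally show ?thesis .
  qed
  have span: "\<exists>c. (\<forall>i<?m. c i \<in> Ok) \<and> \<mu> - (\<Sum>i<?m. \<iota> (c i) * F (\<sigma> i)) \<in> ideal_sq M"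
    if \<mu>: "\<mu> \<in> M" for \<mu>
  proof -
    \<comment> \<open>For \<open>\<mu> \<in> M\<close> the coordinate at 0 lies in
      \<open>Pk\<close>, so it can be divided by \<open>pw 1\<close> within
      \<open>Ok\<close>.\<close>
    define c where "c r = (if r = 0 then cA \<mu> 0 / pw 1 else cA \<mu> r)" for r
    have cO: "c r \<in> Ok" if "r < q" for r
    proof (cases "r = 0")
      case True
      have P: "cA \<mu> 0 \<in> Pk" using M_act[OF \<mu>] by (simp add: cA_0)
      show ?thesis
      proof (cases "cA \<mu> 0 = 0")
        case nz: False
        obtain k where k: "vL (cA \<mu> 0) = Q * k" using K_val[OF cA_K[OF q_pos] nz] by blast
        then have "1 \<le> k" using P nz Q_pos by (auto simp: PK_def zero_less_mult_iff)
        then have "Q * 1 \<le> Q * k" using Q_pos by (intro mult_left_mono) auto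
        then have "0 \<le> vL (cA \<mu> 0 / pw 1)" using nz k by (simp add: v_divide pw_nonzero v_pw)
        then show ?thesis using True K_divide[OF cA_K[OF q_pos] pw_K] by (simp add: c_def OK_def)
      qed (simp add: c_def True)
    qed (use that cA_OK[OF M_R[OF \<mu>]] in \<open>simp add: c_def\<close>)
    have cF: "\<iota> (c r) * F r = \<iota> (cA \<mu> r) * Phi r" if "r < q" for r
    proof (cases "r = 0")
      case True
      have "\<iota> (cA \<mu> 0 / pw 1) * \<iota> (pw 1) = \<iota> (cA \<mu> 0)"
        using iota_mult[OF K_divide[OF cA_K[OF q_pos] pw_K] pw_K, of \<mu> 1 1]
        by (simp add: pw_nonzero)
      then show ?thesis using True by (simp add: c_def F_def Phi_0)
    qed (simp add: c_def F_def)
    have E: "E \<subseteq> {..<q}" by (auto simp: E_iff)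
    have "(\<Sum>i<?m. \<iota> (c (\<sigma> i)) * F (\<sigma> i)) = (\<Sum>r\<in>E. \<iota> (c r) * F r)"
      by (rule sum.reindex_bij_betw[OF \<sigma>])
    also have "\<dots> = (\<Sum>r\<in>E. \<iota> (cA \<mu> r) * Phi r)" using E by (intro sum.cong refl cF) auto
    finally have "\<mu> - (\<Sum>i<?m. \<iota> (c (\<sigma> i)) * F (\<sigma> i))
        = (\<Sum>r<q. \<iota> (cA \<mu> r) * Phi r) - (\<Sum>r\<in>E. \<iota> (cA \<mu> r) * Phi r)"
      by (simp only: cA_sum)
    also have "\<dots> = (\<Sum>r\<in>{..<q} - E. \<iota> (cA \<mu> r) * Phi r)"
      using E by (simp add: sum_diff)
    also have "\<dots> \<in> ideal_sq M"
      using cA_OK[OF M_R[OF \<mu>]] Phi_ideal_sq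
      by (intro A.submod_sum[OF ideal_sq_submod] A.submod_scal[OF ideal_sq_submod]) auto
    finally have "\<mu> - (\<Sum>i<?m. \<iota> (c (\<sigma> i)) * F (\<sigma> i)) \<in> ideal_sq M" .
    moreover have "\<forall>i<?m. c (\<sigma> i) \<in> Ok" using \<sigma> E cO by (auto dest: bij_betwE)
    ultimately show ?thesis by (intro exI[of _ "\<lambda>i. c (\<sigma> i)"]) blast
  qed
  have indep: "c i \<in> Pk"
    if c: "\<forall>i<?m. c i \<in> Ok" and x: "(\<Sum>i<?m. \<iota> (c i) * F (\<sigma> i)) \<in> ideal_sq M" and i: "i < ?m" for c i
  proof -
    define c' where "c' r = c (inv_into {..<?m} \<sigma> r)" for r
    let ?x = "\<Sum>r\<in>E. \<iota> (c' r) * F r"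
    have x': "?x \<in> ideal_sq M" using x by (simp only: reindex c'_def)
    have c'O: "c' r \<in> Ok" if "r \<in> E" for r
      using c bij_betwE[OF bij_betw_inv_into[OF \<sigma>]] that by (auto simp: c'_def)
    have cx: "cA ?x r = (\<Sum>s\<in>E. c' s * cA (F s) r)" if "r < q" for r
      using that c'O OK_K by (simp add: A.coord_sum_fun[OF Phi_basis] A.coord_scal[OF Phi_basis])
    have cF: "cA (F s) r = (if s = r then (if r = 0 then pw 1 else 1) else 0)" if "s < q" "r < q" for s r
    proof (cases "s = 0")
      case True
      have "F s = \<iota> (pw 1) * Phi 0" using True by (simp add: F_def Phi_0)
      then show ?thesis
        using True that by (simp add: A.coord_scal[OF Phi_basis pw_K] cA_Phi)
    qed (use that in \<open>auto simp: F_def cA_Phi\<close>)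
    have val: "cA ?x r = c' r * (if r = 0 then pw 1 else 1)" if r: "r \<in> E" for r
    proof -
      have rq: "r < q" using r by (simp add: E_iff)
      have "cA ?x r = (\<Sum>s\<in>{r}. c' s * (if r = 0 then pw 1 else 1))"
        unfolding cx[OF rq] using E_finite r rq
        by (intro sum.mono_neutral_cong_right) (auto simp: cF E_iff)
      then show ?thesis by simp
    qed
    have "c' r \<in> Pk" if r: "r \<in> E" for r
    proof (cases "r = 0")
      case True
      \<comment> \<open>Of the valuation \<open>2 * Q\<close> the factor \<open>pw 1\<close> uses
        only \<open>Q\<close>, so \<open>c' 0\<close> keeps positive valuation.\<close>
      have "c' 0 * pw 1 \<in> vpow vL (2 * Q)"
        using ideal_sq_act_1[OF x'] val[OF E0] by (simp add: cA_0)
      then have "c' 0 \<in> vpow vL Q"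
        using vpow_mult_iff[OF pw_nonzero, of 1 "c' 0"] by (simp add: v_pw mult.commute)
      then have "c' 0 \<in> vpow vL 1" using Q_pos by (auto elim: vpow_mono)
      then show ?thesis using c'O[OF E0] True by (simp add: PK_eq OK_K)
    next
      case False
      then show ?thesis using ideal_sq_coord[OF x' r] val[OF r] by simp
    qed
    then have "c' (\<sigma> i) \<in> Pk" using bij_betwE[OF \<sigma>] i by blast
    then show ?thesis using \<sigma> i by (simp add: c'_def bij_betw_inv_into_left)
  qed
  show ?thesis
    unfolding kappa_dim_quot_def
    using FM bij_betwE[OF \<sigma>] span indep by (intro exI[of _ "\<lambda>i. F (\<sigma> i)"]) blast
qed

lemma R_residue:
  assumes "\<alpha> \<in> R" shows "\<exists>c\<in>Ok. \<alpha> - \<iota> c \<in> M"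
proof (rule bexI)
  show c: "act \<alpha> 1 \<in> Ok" using assms by (rule act_1_OK)
  show "\<alpha> - \<iota> (act \<alpha> 1) \<in> M"
    using R_diff[OF assms R_iota[OF c]] c by (simp add: M_def act_diff_left act_iota OK_K)
qed

end

theorem theorem3p7:
  fixes K :: "'L::field set" and vL :: "'L \<Rightarrow> int" and p n :: nat
    and \<iota> :: "'L \<Rightarrow> 'A::ring_1" and act :: "'A \<Rightarrow> 'L \<Rightarrow> 'L"
    and bs :: "nat \<Rightarrow> int" and T :: enat and lam :: "int \<Rightarrow> 'L" and Psi :: "nat \<Rightarrow> 'A"
    and h :: int
  assumes "setting K vL p n \<iota> act"
    and "\<forall>i\<in>{1..n}. coprime (bs i) (int p)"
    and "scaffold K vL p n bs act T lam Psi"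
    and "enat (nat (int p ^ n + bpar p n bs h - h)) \<le> T"
  shows "generated_by act (assoc_order act vL h) (vpow vL h) (card (Dset p n bs h))
       \<and> (\<forall>m. generated_by act (assoc_order act vL h) (vpow vL h) m \<longrightarrow> card (Dset p n bs h) \<le> m)
       \<and> is_subring (assoc_order act vL h)
       \<and> (\<exists>M. max_left_ideal (assoc_order act vL h) M
            \<and> (\<forall>M'. max_left_ideal (assoc_order act vL h) M' \<longrightarrow> M' = M)
            \<and> \<iota> ` OK K vL \<subseteq> assoc_order act vL h
            \<and> (\<forall>\<alpha>\<in>assoc_order act vL h. \<exists>c\<in>OK K vL. \<alpha> - \<iota> c \<in> M)
            \<and> (\<forall>c\<in>OK K vL. \<iota> c \<in> M \<longleftrightarrow> c \<in> PK K vL)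
            \<and> kappa_dim_quot \<iota> (OK K vL) (PK K vL) M (card (Eset p n bs h)))"
proof -
  interpret S: scaffold_setting K vL p n \<iota> act bs T lam Psi h
    using assms by unfold_locales
  show ?thesis
  proof (intro conjI exI[of _ S.M])
    show "\<forall>m. generated_by act (assoc_order act vL h) (vpow vL h) m \<longrightarrow> card (Dset p n bs h) \<le> m"
      using S.generators_lower_bound by blast
    show "\<forall>M'. max_left_ideal (assoc_order act vL h) M' \<longrightarrow> M' = S.M" using S.M_unique by blast
    show "\<iota> ` OK K vL \<subseteq> assoc_order act vL h" using S.R_iota by blast
    show "\<forall>\<alpha>\<in>assoc_order act vL h. \<exists>c\<in>OK K vL. \<alpha> - \<iota> c \<in> S.M" using S.R_residue by blast
    show "\<forall>c\<in>OK K vL. \<iota> c \<in> S.M \<longleftrightarrow> c \<in> PK K vL" using S.iota_M by blast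
  qed (rule S.D_generates S.R_subring S.M_max S.embedding_dimension)+
qed

end
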